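(* Let $d\ge2$, $\sigma>0$, $A\in\mathbb{R}^{d\times d}$ symmetric positive definite, $c\in\mathbb{R}^d$, and consider linear bandits on $\mathcal{X}=\{x\in\mathbb{R}^d:\|x-c\|_{A^{-1}}\le1\}$ with independent, centered, $\sigma^2$-subgaussian noise. Let the algorithm be the translation reduction applied with translation vector $c$ to E2TC (for the centered ellipsoid) tuned with $\alpha=3$, variance proxy $2\sigma^2$ and horizon $T/2$. Then for every $\theta\in\mathbb{R}^d\setminus\{0\}$ and every $T\ge1$, $$R_T(\theta)\le 7d\sigma\sqrt T + \frac{2622\,\sigma^2d^2}{\|\theta\|_A}\,\overline{\log}\Big(\frac{T\|\theta\|_A^2}{4\sigma^2d^2}\Big) + 2T\|\theta\|_A\exp\Big(\big(2d/3-(1/9)\sqrt T\|\theta\|_A/\sigma\big)^-\Big) + 392\,d\|\theta\|_A.$$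
   Context: $\|u\|_M := \sqrt{u^\top M u}$; $\overline{\log}(x):=1+\log(\max(x,1))$; $(x)^-:=\min(x,0)$. Model: at each $t=1,\dots,T$ the learner picks $x_t\in\mathcal{X}$ based on past observations, observes $y_t=x_t^\top\theta+z_t$, $z_t$ independent, centered, $\sigma^2$-subgaussian ($\mathbb{E}[e^{\lambda z_t}]\le e^{\lambda^2\sigma^2/2}$). Regret $R_T(\theta)=\mathbb{E}[\sum_{t=1}^T(x^\star(\theta)-x_t)^\top\theta]$ with $x^\star(\theta)=c+A\theta/\|\theta\|_A$. Centered E2TC (inputs $A$, variance proxy $s^2$, horizon $H$, $\alpha$), for the action set $\{x:\|x\|_{A^{-1}}\le1\}$: round-robin exploration for $m$ rounds ($m$ multiple of $d$) plays $A^{1/2}e_j$ with $j$ cycling through $1,\dots,d$; LS estimate of a block is $(X^\top X)^{-1}X^\top Y$. With $n_i=d2^{i-1}$, $\delta_i=\min(dn_i/H,1)$, $U(\delta,n)^2=\frac{s^2d^2}{n}\big(1+2\sqrt{\tfrac1d\log\tfrac1\delta}+\tfrac2d\log\tfrac1\delta\big)$: Phase 1: for $i=1,2,\dots$ round-robin explore $n_i$ rounds, $\hat\theta_i$ LS from these rounds only, stop at first $i$ with $\|\hat\theta_i\|_A>\alpha U(\delta_i,n_i)$, $\hat B=\|\hat\theta_i\|_A$; Phase 2: round-robin explore $N_e=d\lceil s\sqrt H/\hat B\rceil$ rounds, $\hat\theta$ LS from these rounds; Phase 3 (commit): commit to $x_{\mathrm{commit}} = A\hat\theta/\|\hat\theta\|_A$.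 Translation reduction with vector $c$: each time the centered algorithm requests an exploration action $\tilde x$ (Phases 1–2), the learner plays $c$ and then $c+\tilde x$ in two consecutive rounds, obtaining rewards $y, y'$, and feeds $y'-y$ (which equals $\theta^\top\tilde x$ plus $2\sigma^2$-subgaussian noise) to the centered algorithm as the reward of $\tilde x$; once the centered algorithm commits to $x_{\mathrm{commit}}$, the learner plays $c+x_{\mathrm{commit}}$ until time $T$. All plays stop at time $T$. *)

theory Defs
  imports "HOL-Analysis.Analysis" "HOL-Probability.Probability"
begin

definition normM :: "real^'n^'n \<Rightarrow> real^'n \<Rightarrow> real" where
  "normM M u = sqrt (u \<bullet> (M *v u))"

definition lbar :: "real \<Rightarrow> real" where
  "lbar x = 1 + ln (max x 1)"

definition negpart :: "real \<Rightarrow> real" where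
  "negpart x = min x 0"

definition spd :: "real^'n^'n \<Rightarrow> bool" where
  "spd A \<longleftrightarrow> transpose A = A \<and> (\<forall>x. x \<noteq> 0 \<longrightarrow> 0 < x \<bullet> (A *v x))"

definition msqrt :: "real^'n^'n \<Rightarrow> real^'n^'n" where
  "msqrt A = (THE S. spd S \<and> S ** S = A)"

definition outer :: "real^'n \<Rightarrow> real^'n \<Rightarrow> real^'n^'n" where
  "outer x y = (\<chi> i j. x $ i * y $ j)"

text \<open>Round-robin exploration action at centered step k (0-indexed):
  A^(1/2) e_j with j = k mod d, where the coordinates are enumerated by ord.\<close>
definition rr_action :: "real^'n^'n \<Rightarrow> (nat \<Rightarrow> 'n) \<Rightarrow> nat \<Rightarrow> real^'n" where
  "rr_action A ord k = msqrt A *v axis (ord (k mod CARD('n))) 1"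

text \<open>Least squares estimate (X^T X)^{-1} X^T Y from the exploration steps in K,
  where r k is the reward fed to the centered algorithm at centered step k.\<close>
definition ls_est :: "real^'n^'n \<Rightarrow> (nat \<Rightarrow> 'n) \<Rightarrow> (nat \<Rightarrow> real) \<Rightarrow> nat set \<Rightarrow> real^'n" where
  "ls_est A ord r K =
     matrix_inv (\<Sum>k\<in>K. outer (rr_action A ord k) (rr_action A ord k))
       *v (\<Sum>k\<in>K. r k *\<^sub>R rr_action A ord k)"

definition Ufun :: "real \<Rightarrow> nat \<Rightarrow> real \<Rightarrow> nat \<Rightarrow> real" where
  "Ufun s2 d \<delta> n = sqrt (s2 * real d ^ 2 / real n *
      (1 + 2 * sqrt ((1 / real d) * ln (1 / \<delta>)) + (2 / real d) * ln (1 / \<delta>)))"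

definition blk_len :: "nat \<Rightarrow> nat \<Rightarrow> nat" where
  "blk_len d i = d * 2 ^ (i - 1)"

definition blk_start :: "nat \<Rightarrow> nat \<Rightarrow> nat" where
  "blk_start d i = (\<Sum>j\<in>{1..<i}. blk_len d j)"

definition delta_i :: "nat \<Rightarrow> real \<Rightarrow> nat \<Rightarrow> real" where
  "delta_i d H n = min (real d * real n / H) 1"

definition phase1_est :: "real^'n^'n \<Rightarrow> (nat \<Rightarrow> 'n) \<Rightarrow> (nat \<Rightarrow> real) \<Rightarrow> nat \<Rightarrow> real^'n" where
  "phase1_est A ord r i =
     ls_est A ord r {blk_start CARD('n) i ..< blk_start CARD('n) i + blk_len CARD('n) i}"

definition phase1_stop :: "real^'n^'n \<Rightarrow> (nat \<Rightarrow> 'n) \<Rightarrow> real \<Rightarrow> real \<Rightarrow> real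
     \<Rightarrow> (nat \<Rightarrow> real) \<Rightarrow> nat \<Rightarrow> bool" where
  "phase1_stop A ord s2 H \<alpha> r i \<longleftrightarrow>
     normM A (phase1_est A ord r i) >
       \<alpha> * Ufun s2 CARD('n) (delta_i CARD('n) H (blk_len CARD('n) i)) (blk_len CARD('n) i)"

text \<open>Centered E2TC (inputs A, variance proxy s2, horizon H, alpha), run on the reward
  sequence r (r k = reward of the k-th exploration action, k = 0,1,...).
  Result: None if Phase 1 never stops; otherwise Some (K, x_commit) where K is the
  total number of exploration steps (Phases 1 and 2) and x_commit the committed action.\<close>
definition e2tc :: "real^'n^'n \<Rightarrow> (nat \<Rightarrow> 'n) \<Rightarrow> real \<Rightarrow> real \<Rightarrow> real
     \<Rightarrow> (nat \<Rightarrow> real) \<Rightarrow> (nat \<times> (real^'n)) option" where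
  "e2tc A ord s2 H \<alpha> r =
     (if \<exists>i\<ge>1. phase1_stop A ord s2 H \<alpha> r i then
        (let i = (LEAST i. 1 \<le> i \<and> phase1_stop A ord s2 H \<alpha> r i);
             Bh = normM A (phase1_est A ord r i);
             E1 = blk_start CARD('n) i + blk_len CARD('n) i;
             Ne = CARD('n) * nat \<lceil>sqrt s2 * sqrt H / Bh\<rceil>;
             th = ls_est A ord r {E1 ..< E1 + Ne}
         in Some (E1 + Ne, (1 / normM A th) *\<^sub>R (A *v th)))
      else None)"

text \<open>Translation reduction with vector c: action at learner round t >= 1.
  Centered exploration step k uses learner rounds 2k+1 (play c) and 2k+2 (play c + x~_k).\<close>
definition reduction_action :: "real^'n \<Rightarrow> real^'n^'n \<Rightarrow> (nat \<Rightarrow> 'n) \<Rightarrow> real \<Rightarrow> real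
     \<Rightarrow> real \<Rightarrow> (nat \<Rightarrow> real) \<Rightarrow> nat \<Rightarrow> real^'n" where
  "reduction_action c A ord s2 H \<alpha> r t =
     (let k = (t - 1) div 2;
          explore = (if even (t - 1) then c else c + rr_action A ord k)
      in case e2tc A ord s2 H \<alpha> r of
           None \<Rightarrow> explore
         | Some (K, xc) \<Rightarrow> (if k < K then explore else c + xc))"

definition x_star :: "real^'n^'n \<Rightarrow> real^'n \<Rightarrow> real^'n \<Rightarrow> real^'n" where
  "x_star A c \<theta> = c + (1 / normM A \<theta>) *\<^sub>R (A *v \<theta>)"

end

(* In the coordinates p = A^(1/2) theta, with a = |p| = normM A theta, a block of d m exploration
   steps yields A^(1/2) theta_hat = p + xi, where xi has independent coordinates that are
   (2 sigma^2 / m)-subgaussian.  Let i0 be the first block with a > 5 U(i0).  Phase 1 stops by i0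
   with 3/5 <= Bhat / a <= 3/2 unless one of two failures occurs: an early block overestimates
   (Bhat >= 3 U(i) and Bhat >= 3a/2), or block i0 deviates (|xi| >= 2 U(i0)).  A failure costs
   at most 2 a T, and 2 a T delta_i = 4 a d n_i carries one factor d too many.  Chernoff bounds for
   |p + xi|^2, taken with the mean p, give failure probabilities delta_i exp(- const d), and
   d exp(- const d) is bounded.  The failures therefore cost no more than a constant times a n_(i0),
   the order of the Phase 1 cost, and the definition of i0 turns a n_(i0) into the logarithmic term.

   On success, with beta = Bhat / a, Phases 2 and 3 cost d sigma sqrt(T) (3/beta + 2 beta), at most
   7 d sigma sqrt(T), plus 2 a T times the probability that the committed direction makes an angle
   of at least 90 degrees with p, which requires |xi| >= a. *)

theory Submission
  imports Defs "HOL-Real_Asymp.Real_Asymp"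
begin

section \<open>Square roots of positive definite matrices\<close>

text \<open>The block at which Phase 1 stops and the number of cycles of Phase 2 are random, and the
  second depends on the estimate made at the first. The regret is therefore bounded path by path by
  a sum over all pairs of a stopping block and a cycle number, finitely many because Bhat >= 3a/5
  caps the latter. The event of each pair is determined by the Phase 1 noise, hence independent of
  the noise of Phase 2, and the events are disjoint, so one bound on the cost given the event serves
  for all pairs at once.

  The factor 5 in the choice of i0, against the threshold factor 3 of the algorithm, leaves room for
  a deviation of 2 U(i0) and yields the ratio 3/5. One exploration step takes two rounds and costs
  3a: a for playing c, at most 2a for its translate.

  The square root \<open>msqrt\<close> is a definite description, so existence and uniqueness of a
  positive definite root have to be settled before the coordinates p make sense; both rest on an
  orthonormal eigenbasis.\<close>

lemma self_adjoint_eigenvector: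
  fixes f :: "'a::euclidean_space \<Rightarrow> 'a"
  assumes lin: "linear f" and sa: "\<And>x y. f x \<bullet> y = x \<bullet> f y"
    and sub: "subspace S" and inv: "f ` S \<subseteq> S" and nz: "S \<noteq> {0}"
  obtains v where "v \<in> S" "norm v = 1" "f v = (v \<bullet> f v) *\<^sub>R v"
proof -
  let ?K = "S \<inter> sphere 0 1"
  have cK: "compact ?K"
    by (intro closed_Int_compact closed_subspace sub compact_sphere)
  obtain u where u: "u \<in> S" "u \<noteq> 0" using nz subspace_0[OF sub] by blast
  have "(1 / norm u) *\<^sub>R u \<in> ?K" using u sub by (simp add: subspace_scale)
  hence neK: "?K \<noteq> {}" by blast
  have cont: "continuous_on ?K (\<lambda>x. x \<bullet> f x)"
    by (intro continuous_intros linear_continuous_on) (simp add: lin linear_conv_bounded_linear[symmetric])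
  obtain v where v: "v \<in> ?K" and vmax: "\<And>y. y \<in> ?K \<Longrightarrow> y \<bullet> f y \<le> v \<bullet> f v"
    using continuous_attains_sup[OF cK neK cont] by blast
  define \<mu> where "\<mu> = v \<bullet> f v"
  define g where "g x = \<mu> *\<^sub>R x - f x" for x
  have g_add: "g (x + y) = g x + g y" and g_scale: "g (t *\<^sub>R x) = t *\<^sub>R g x" for x y t
    using linear_add[OF lin] linear_scale[OF lin] by (simp_all add: g_def algebra_simps)
  have g_sa: "g x \<bullet> y = x \<bullet> g y" for x y
    using sa by (simp add: g_def inner_diff_left inner_diff_right)
  have gS: "g x \<in> S" if "x \<in> S" for x
    using that inv sub by (auto simp: g_def intro!: subspace_diff subspace_scale)
  have Q: "0 \<le> x \<bullet> g x" if x: "x \<in> S" for x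
  proof (cases "x = 0")
    case False
    have "(1 / norm x) *\<^sub>R x \<in> ?K" using x False sub by (simp add: subspace_scale)
    from vmax[OF this] have "(x \<bullet> f x) / (norm x)\<^sup>2 \<le> \<mu>"
      by (simp add: linear_scale[OF lin] \<mu>_def power2_eq_square)
    hence "x \<bullet> f x \<le> \<mu> * (norm x)\<^sup>2" using False by (simp add: divide_simps)
    thus ?thesis by (simp add: g_def inner_diff_right power2_norm_eq_inner)
  qed (simp add: g_def)
  have nv: "norm v = 1" and vS: "v \<in> S" using v by auto
  have vg: "v \<bullet> g v = 0"
    using nv by (simp add: g_def inner_diff_right \<mu>_def power2_norm_eq_inner[symmetric])
  \<comment> \<open>On \<open>S\<close> the form of \<open>g\<close> is nonnegative and vanishes at
    the maximizer \<open>v\<close>. If \<open>g v\<close> were nonzero, moving from \<open>v\<close>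
    by \<open>-e w\<close> would change the form by -2 e n + e^2 q, which is negative for e = n / (q
    + 1).\<close>
  define w where "w = g v"
  have wS: "w \<in> S" using gS vS w_def by simp
  have "w = 0"
  proof (rule ccontr)
    assume wn: "w \<noteq> 0"
    define q where "q = w \<bullet> g w"
    have q0: "0 \<le> q" using Q[OF wS] q_def by simp
    define n where "n = w \<bullet> w"
    have n0: "0 < n" using wn by (simp add: n_def)
    define e where "e = n / (q + 1)"
    have e0: "0 < e" using n0 q0 by (simp add: e_def)
    have "0 \<le> (v + (-e) *\<^sub>R w) \<bullet> g (v + (-e) *\<^sub>R w)"
      by (intro Q subspace_add subspace_scale sub vS wS)
    also have "\<dots> = v \<bullet> g v - e * (w \<bullet> g v) - e * (v \<bullet> g w) + e * e * (w \<bullet> g w)"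
      by (simp add: g_add g_scale inner_add_left inner_add_right algebra_simps
          del: scaleR_minus_left scaleR_left_diff_distrib)
    also have "v \<bullet> g w = n" using g_sa[of v w] by (simp add: n_def w_def)
    also have "w \<bullet> g v = n" by (simp add: n_def w_def)
    finally have "0 \<le> e * (e * q - 2 * n)" using vg by (simp add: q_def algebra_simps)
    hence "2 * n \<le> e * q" using e0 by (simp add: zero_le_mult_iff)
    also have "e * q \<le> n" using n0 q0 by (simp add: e_def field_simps)
    finally show False using n0 by simp
  qed
  hence "f v = (v \<bullet> f v) *\<^sub>R v" by (simp add: w_def g_def \<mu>_def)
  with that vS nv show ?thesis by blast
qed

text \<open>Self-adjointness makes the complement in \<open>S\<close> of one eigenvector invariant
  again, so induction on the dimension splits off one unit eigenvector at a time. The expansion of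
  each x in \<open>B\<close> is carried along, since later uses need coordinates rather than
  spans.\<close>

lemma self_adjoint_orthonormal_eigenbasis:
  fixes f :: "'a::euclidean_space \<Rightarrow> 'a"
  assumes lin: "linear f" and sa: "\<And>x y. f x \<bullet> y = x \<bullet> f y"
    and "subspace S" and "f ` S \<subseteq> S"
  shows "\<exists>B. finite B \<and> B \<subseteq> S \<and> (\<forall>b\<in>B. \<forall>c\<in>B. b \<bullet> c = (if b = c then 1 else 0)) \<and>
    (\<forall>b\<in>B. f b = (b \<bullet> f b) *\<^sub>R b) \<and> (\<forall>x\<in>S. x = (\<Sum>b\<in>B. (x \<bullet> b) *\<^sub>R b))"
  using assms(3,4)
proof (induction "dim S" arbitrary: S rule: less_induct)
  case less
  show ?case
  proof (cases "S = {0}")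
    case True
    thus ?thesis by (intro exI[of _ "{}"]) auto
  next
    case False
    obtain v where v: "v \<in> S" "norm v = 1" "f v = (v \<bullet> f v) *\<^sub>R v"
      using self_adjoint_eigenvector[OF lin sa less.prems False] by blast
    have vv: "v \<bullet> v = 1" using v(2) by (simp add: norm_eq_1)
    define S' where "S' = {y \<in> S. v \<bullet> y = 0}"
    have sub': "subspace S'"
      using less.prems(1) by (auto simp: S'_def subspace_def inner_add_right)
    have inv': "f ` S' \<subseteq> S'"
    proof
      fix z assume "z \<in> f ` S'"
      then obtain y where y: "y \<in> S" "v \<bullet> y = 0" "z = f y" by (auto simp: S'_def)
      have "v \<bullet> f y = f v \<bullet> y" using sa by simp
      also have "\<dots> = (v \<bullet> f v) * (v \<bullet> y)" using arg_cong[OF v(3), of "\<lambda>u. u \<bullet> y"] by (simp only: inner_scaleR_left)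
      finally show "z \<in> S'" using y less.prems(2) by (auto simp: S'_def)
    qed
    have "v \<notin> S'" "S' \<subseteq> S" using vv by (auto simp: S'_def)
    hence "S' \<subset> S" using v(1) by blast
    hence "dim S' < dim S"
      by (metis dim_psubset less.prems(1) span_eq_iff sub')
    from less.hyps[OF this sub' inv'] obtain B where B: "finite B" "B \<subseteq> S'"
      "\<forall>b\<in>B. \<forall>c\<in>B. b \<bullet> c = (if b = c then 1 else 0)"
      "\<forall>b\<in>B. f b = (b \<bullet> f b) *\<^sub>R b" "\<forall>x\<in>S'. x = (\<Sum>b\<in>B. (x \<bullet> b) *\<^sub>R b)" by blast
    have vB: "v \<bullet> b = 0" "b \<bullet> v = 0" if "b \<in> B" for b
      using that B(2) by (auto simp: S'_def inner_commute)
    hence vnB: "v \<notin> B" using vv by fastforce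
    have "x = (\<Sum>b\<in>insert v B. (x \<bullet> b) *\<^sub>R b)" if x: "x \<in> S" for x
    proof -
      let ?y = "x - (x \<bullet> v) *\<^sub>R v"
      have "?y \<in> S'" using x v(1) vv less.prems(1)
        by (simp add: S'_def subspace_diff subspace_scale inner_diff_right inner_commute)
      hence "?y = (\<Sum>b\<in>B. (?y \<bullet> b) *\<^sub>R b)" using B(5) by blast
      also have "\<dots> = (\<Sum>b\<in>B. (x \<bullet> b) *\<^sub>R b)"
        by (rule sum.cong) (auto simp: inner_diff_left vB)
      finally show ?thesis using vnB B(1) by (simp add: algebra_simps)
    qed
    moreover have "insert v B \<subseteq> S" using B(2) v(1) by (auto simp: S'_def)
    moreover have "\<forall>b\<in>insert v B. \<forall>c\<in>insert v B. b \<bullet> c = (if b = c then 1 else 0)"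
      using B(3) vv vB vnB by auto
    moreover have "\<forall>b\<in>insert v B. f b = (b \<bullet> f b) *\<^sub>R b" using B(4) v(3) by blast
    ultimately show ?thesis using B(1) by (intro exI[of _ "insert v B"]) blast
  qed
qed

lemma transpose_inner:
  fixes A :: "real^'n^'n"
  shows "(transpose A *v x) \<bullet> y = x \<bullet> (A *v y)"
  unfolding transpose_matrix_vector by (rule dot_lmul_matrix)

lemma symmetric_iff_self_adjoint:
  fixes A :: "real^'n^'n"
  shows "transpose A = A \<longleftrightarrow> (\<forall>x y. (A *v x) \<bullet> y = x \<bullet> (A *v y))"
proof
  assume "transpose A = A"
  thus "\<forall>x y. (A *v x) \<bullet> y = x \<bullet> (A *v y)"
    using transpose_inner[of A] by simp
next
  assume *: "\<forall>x y. (A *v x) \<bullet> y = x \<bullet> (A *v y)"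
  have "transpose A *v x = A *v x" for x
  proof -
    have "\<forall>y. (transpose A *v x) \<bullet> y = (A *v x) \<bullet> y"
      using * by (simp only: transpose_inner) simp
    thus ?thesis by (simp only: vector_eq_rdot)
  qed
  thus "transpose A = A" by (simp add: matrix_eq)
qed

lemma spd_symmetric: "spd A \<Longrightarrow> (A *v x) \<bullet> y = x \<bullet> (A *v y)"
  unfolding spd_def symmetric_iff_self_adjoint by blast

text \<open>The root multiplies each eigenvector by the square root of its eigenvalue. It is built
  as a linear map \<open>g\<close> and turned into a matrix at the end.\<close>

lemma spd_sqrt_exists:
  fixes A :: "real^'n^'n"
  assumes A: "spd A"
  shows "\<exists>S. spd S \<and> S ** S = A"
proof -
  define f where "f = (*v) A"
  have lin: "linear f" by (simp add: f_def)
  have sa: "f x \<bullet> y = x \<bullet> f y" for x y using spd_symmetric[OF A] by (simp add: f_def)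
  obtain B where B: "finite B" "\<forall>b\<in>B. \<forall>c\<in>B. b \<bullet> c = (if b = c then 1 else 0)"
      "\<forall>b\<in>B. f b = (b \<bullet> f b) *\<^sub>R b" "\<forall>x. x = (\<Sum>b\<in>B. (x \<bullet> b) *\<^sub>R b)"
    using self_adjoint_orthonormal_eigenbasis[OF lin sa subspace_UNIV subset_UNIV] by blast
  define \<mu> where "\<mu> b = b \<bullet> f b" for b
  have mu: "0 < \<mu> b" if "b \<in> B" for b
  proof -
    have "b \<noteq> 0" using B(2) that by force
    thus ?thesis using A by (simp add: \<mu>_def f_def spd_def)
  qed
  define g where "g x = (\<Sum>b\<in>B. (sqrt (\<mu> b) * (x \<bullet> b)) *\<^sub>R b)" for x
  have lg: "linear g"
    by (rule linearI) (simp_all add: g_def inner_add_left algebra_simps sum.distrib scaleR_right.sum)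
  have gb: "g x \<bullet> b = sqrt (\<mu> b) * (x \<bullet> b)" if "b \<in> B" for x b
  proof -
    have "g x \<bullet> b = (\<Sum>c\<in>B. sqrt (\<mu> c) * (x \<bullet> c) * (if c = b then 1 else 0))"
      unfolding g_def inner_sum_left using B(2) that by (intro sum.cong) auto
    thus ?thesis using that B(1) by (simp add: if_distrib sum.delta cong: if_cong)
  qed
  have gg: "g (g x) = f x" for x
  proof -
    have "g (g x) = (\<Sum>b\<in>B. (\<mu> b * (x \<bullet> b)) *\<^sub>R b)"
      unfolding g_def[of "g x"] by (rule sum.cong) (use mu gb in \<open>auto simp: less_imp_le\<close>)
    also have "\<dots> = (\<Sum>b\<in>B. (x \<bullet> b) *\<^sub>R f b)"
    proof (rule sum.cong)
      fix b assume "b \<in> B"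
      hence "f b = \<mu> b *\<^sub>R b" using B(3) unfolding \<mu>_def by blast
      thus "(\<mu> b * (x \<bullet> b)) *\<^sub>R b = (x \<bullet> b) *\<^sub>R f b" by (simp add: mult.commute)
    qed simp
    also have "\<dots> = f (\<Sum>b\<in>B. (x \<bullet> b) *\<^sub>R b)"
      by (simp add: linear_sum[OF lin] linear_scale[OF lin])
    also have "(\<Sum>b\<in>B. (x \<bullet> b) *\<^sub>R b) = x" by (rule B(4)[rule_format, symmetric])
    finally show ?thesis .
  qed
  have gx: "x \<bullet> g y = (\<Sum>b\<in>B. sqrt (\<mu> b) * ((x \<bullet> b) * (y \<bullet> b)))" for x y
    by (simp add: g_def inner_sum_right mult_ac)
  have gsa: "g x \<bullet> y = x \<bullet> g y" for x y
    using gx[of x y] gx[of y x] by (simp add: inner_commute mult_ac)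
  have gpos: "0 < x \<bullet> g x" if "x \<noteq> 0" for x
  proof -
    have "\<exists>b\<in>B. x \<bullet> b \<noteq> 0"
    proof (rule ccontr)
      assume "\<not> ?thesis"
      hence "(\<Sum>b\<in>B. (x \<bullet> b) *\<^sub>R b) = 0" by (simp add: sum.neutral)
      moreover have "(\<Sum>b\<in>B. (x \<bullet> b) *\<^sub>R b) = x" by (rule B(4)[rule_format, symmetric])
      ultimately show False using that by simp
    qed
    then obtain b where b: "b \<in> B" "x \<bullet> b \<noteq> 0" by blast
    have "0 < sqrt (\<mu> b) * ((x \<bullet> b) * (x \<bullet> b))" using b mu by (auto simp: zero_less_mult_iff linorder_neq_iff)
    moreover have "0 \<le> sqrt (\<mu> c) * ((x \<bullet> c) * (x \<bullet> c))" if "c \<in> B" for c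
      using mu[OF that] by simp
    ultimately show ?thesis unfolding gx using B(1) b(1) by (intro sum_pos2) auto
  qed
  let ?S = "matrix g"
  have S: "?S *v x = g x" for x by (simp add: lg)
  have "spd ?S" unfolding spd_def symmetric_iff_self_adjoint S using gsa gpos by simp
  moreover have "?S ** ?S = A"
    unfolding matrix_eq matrix_vector_mul_assoc[symmetric] S gg by (simp add: f_def)
  ultimately show ?thesis by blast
qed

text \<open>The difference R - S is self-adjoint, so it is zero as soon as all its eigenvalues are.
  An eigenvalue l with unit eigenvector b satisfies l (b.Rb + b.Sb) = 0, and the second factor is
  positive.\<close>

lemma spd_sqrt_unique:
  fixes R S :: "real^'n^'n"
  assumes R: "spd R" and S: "spd S" and eq: "R ** R = S ** S"
  shows "R = S"
proof -
  define f where "f x = R *v x - S *v x" for x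
  have lin: "linear f" unfolding f_def by (intro linear_compose_sub) auto
  have sa: "f x \<bullet> y = x \<bullet> f y" for x y
    using spd_symmetric[OF R] spd_symmetric[OF S] by (simp add: f_def inner_diff_left inner_diff_right)
  obtain B where B: "finite B" "\<forall>b\<in>B. \<forall>c\<in>B. b \<bullet> c = (if b = c then 1 else 0)"
      "\<forall>b\<in>B. f b = (b \<bullet> f b) *\<^sub>R b" "\<forall>x. x = (\<Sum>b\<in>B. (x \<bullet> b) *\<^sub>R b)"
    using self_adjoint_orthonormal_eigenbasis[OF lin sa subspace_UNIV subset_UNIV] by blast
  have fb: "f b = 0" if b: "b \<in> B" for b
  proof -
    define l where "l = b \<bullet> f b"
    have fl: "f b = l *\<^sub>R b" using B(3) b l_def by simp
    have bn: "b \<noteq> 0" using B(2) b by force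
    have "R *v (R *v b) = S *v (S *v b)" using eq by (simp add: matrix_vector_mul_assoc)
    \<comment> \<open>\<open>R\<^sup>2 - S\<^sup>2 = R D + D S\<close> for \<open>D = R - S\<close>, tested against the eigenvector \<open>b\<close> of \<open>D\<close>\<close>
    hence "0 = b \<bullet> (R *v (f b)) + b \<bullet> f (S *v b)"
      by (simp add: f_def matrix_vector_mult_diff_distrib inner_diff_right)
    also have "b \<bullet> f (S *v b) = f b \<bullet> (S *v b)" using sa by simp
    also have "b \<bullet> (R *v (f b)) = l * (b \<bullet> (R *v b))" 
      by (simp add: fl matrix_vector_mult_scaleR)
    also have "f b \<bullet> (S *v b) = l * (b \<bullet> (S *v b))" by (simp add: fl)
    finally have "l * (b \<bullet> (R *v b) + b \<bullet> (S *v b)) = 0" by (simp add: algebra_simps)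
    moreover have "0 < b \<bullet> (R *v b) + b \<bullet> (S *v b)"
      using R S bn by (auto simp: spd_def intro!: add_pos_pos)
    ultimately show ?thesis by (simp add: fl)
  qed
  have "f x = 0" for x
  proof -
    have "f x = f (\<Sum>b\<in>B. (x \<bullet> b) *\<^sub>R b)" by (rule arg_cong[OF B(4)[rule_format]])
    also have "\<dots> = 0" by (simp add: linear_sum[OF lin] linear_scale[OF lin] fb)
    finally show ?thesis .
  qed
  thus ?thesis by (simp add: f_def matrix_eq)
qed

lemma msqrt:
  fixes A :: "real^'n^'n"
  assumes A: "spd A"
  shows msqrt_spd: "spd (msqrt A)" and msqrt_mult: "msqrt A ** msqrt A = A"
proof -
  obtain S where S: "spd S" "S ** S = A" using spd_sqrt_exists[OF A] by blast
  have "msqrt A = S"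
    unfolding msqrt_def by (rule the_equality) (use S in \<open>auto intro: spd_sqrt_unique\<close>)
  thus "spd (msqrt A)" "msqrt A ** msqrt A = A" using S by simp_all
qed

section \<open>Least squares under round-robin exploration\<close>

lemma normM_msqrt:
  assumes "spd A"
  shows "normM A u = norm (msqrt A *v u)"
proof -
  have "u \<bullet> (A *v u) = u \<bullet> (msqrt A *v (msqrt A *v u))"
    by (simp add: matrix_vector_mul_assoc msqrt_mult[OF assms])
  also have "\<dots> = (msqrt A *v u) \<bullet> (msqrt A *v u)"
    by (simp add: spd_symmetric[OF msqrt_spd[OF assms]])
  finally show ?thesis by (simp add: normM_def norm_eq_sqrt_inner)
qed

lemma inner_spd_msqrt:
  assumes "spd A"
  shows "(A *v u) \<bullet> v = (msqrt A *v u) \<bullet> (msqrt A *v v)"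
proof -
  have "(A *v u) \<bullet> v = (msqrt A *v (msqrt A *v u)) \<bullet> v"
    by (simp add: matrix_vector_mul_assoc msqrt_mult[OF assms])
  thus ?thesis by (simp add: spd_symmetric[OF msqrt_spd[OF assms]])
qed

lemma rr_action_inner:
  fixes A :: "real^'n^'n"
  assumes "spd A"
  shows "rr_action A ord k \<bullet> \<theta> = (msqrt A *v \<theta>) $ ord (k mod CARD('n))"
  by (simp add: rr_action_def spd_symmetric[OF msqrt_spd[OF assms]] inner_axis')

lemma invertible_matrix_inv_mult:
  fixes G :: "real^'n^'n"
  assumes inj: "\<And>x. G *v x = 0 \<Longrightarrow> x = 0"
  shows "matrix_inv G *v (G *v x) = x"
proof -
  have "invertible G"
    using inj by (simp add: invertible_left_inverse matrix_left_invertible_injective vec.inj_iff_eq_0)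
  hence "\<exists>B. G ** B = mat 1 \<and> B ** G = mat 1" by (simp add: invertible_def)
  hence "matrix_inv G ** G = mat 1" unfolding matrix_inv_def by (rule someI2_ex) simp
  thus ?thesis by (simp add: matrix_vector_mul_assoc)
qed

lemma spd_inj: "spd A \<Longrightarrow> A *v x = 0 \<Longrightarrow> x = 0"
  unfolding spd_def by (metis inner_zero_right less_irrefl)

lemma outer_mult: "outer x y *v u = (y \<bullet> u) *\<^sub>R x"
  by (simp add: vec_eq_iff outer_def matrix_vector_mult_def inner_vec_def sum_distrib_left sum_distrib_right mult_ac)

lemma sum_matrix_vector: "(\<Sum>k\<in>K. F k) *v u = (\<Sum>k\<in>K. F k *v u)" for F :: "'b \<Rightarrow> real^'n^'n"
  by (induction K rule: infinite_finite_induct) (simp_all add: matrix_vector_mult_add_rdistrib)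

text \<open>Least squares estimates \<open>A\<^sup>1\<^sup>/\<^sup>2 \<theta>\<close> by this vector when \<open>r\<close> holds the rewards; it averages
  over the \<open>m\<close> round-robin cycles that follow the first \<open>b\<close> cycles.\<close>
definition block_avg :: "(nat \<Rightarrow> 'n) \<Rightarrow> nat \<Rightarrow> nat \<Rightarrow> (nat \<Rightarrow> real) \<Rightarrow> real^'n" where
  "block_avg ord b m r =
     (\<chi> j. (\<Sum>q<m. r (CARD('n) * (b + q) + inv_into {..<CARD('n)} ord j)) / real m)"

text \<open>Regroups whole cycles by coordinate: in cycle b + q the coordinate j is played at the
  position that \<open>ord\<close> assigns to it. The summand is kept general so that the design
  matrix and the reward vector are both instances.\<close>

lemma sum_round_robin:
  fixes ord :: "nat \<Rightarrow> 'n::finite" and F :: "nat \<Rightarrow> 'n \<Rightarrow> 'b::comm_monoid_add"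
  assumes ord: "bij_betw ord {..<CARD('n)} UNIV"
  shows "(\<Sum>k\<in>{CARD('n) * b..<CARD('n) * b + CARD('n) * m}. F k (ord (k mod CARD('n)))) =
    (\<Sum>j\<in>UNIV. \<Sum>q<m. F (CARD('n) * (b + q) + inv_into {..<CARD('n)} ord j) j)"
proof (induction m)
  case (Suc m)
  let ?d = "CARD('n)" and ?f = "\<lambda>k. F k (ord (k mod CARD('n)))"
  have "(\<Sum>k\<in>{?d * b..<?d * b + ?d * Suc m}. ?f k) =
      (\<Sum>k\<in>{?d * b..<?d * b + ?d * m}. ?f k) + (\<Sum>k\<in>{?d * (b + m)..<?d * (b + m) + ?d}. ?f k)"
    by (subst sum.atLeastLessThan_concat[symmetric, of _ "?d * b + ?d * m"]) (auto simp: algebra_simps)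
  also have "(\<Sum>k\<in>{?d * (b + m)..<?d * (b + m) + ?d}. ?f k) =
      (\<Sum>k\<in>{0 + ?d * (b + m)..<?d + ?d * (b + m)}. ?f k)" by (simp add: add.commute)
  also have "\<dots> = (\<Sum>k<?d. ?f (k + ?d * (b + m)))"
    unfolding sum.shift_bounds_nat_ivl by (simp add: lessThan_atLeast0)
  also have "\<dots> = (\<Sum>k<?d. F (?d * (b + m) + inv_into {..<?d} ord (ord k)) (ord k))"
    by (rule sum.cong) (use ord in \<open>auto simp: bij_betw_def add.commute\<close>)
  also have "\<dots> = (\<Sum>j\<in>UNIV. F (?d * (b + m) + inv_into {..<?d} ord j) j)"
    by (rule sum.reindex_bij_betw[OF ord])
  finally show ?case using Suc.IH by (simp add: sum.distrib)
qed simp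

text \<open>Let S be the root of \<open>A\<close>. In m cycles every column of S is played m times,
  so the design matrix is m S S, while the reward vector is m S applied to the coordinatewise
  average. The estimate is thus the preimage of that average under S.\<close>

lemma msqrt_ls_est:
  fixes A :: "real^'n^'n"
  assumes A: "spd A" and ord: "bij_betw ord {..<CARD('n)} UNIV" and m: "0 < m"
  shows "msqrt A *v ls_est A ord r {CARD('n) * b..<CARD('n) * b + CARD('n) * m} = block_avg ord b m r"
proof -
  let ?K = "{CARD('n) * b..<CARD('n) * b + CARD('n) * m}" and ?S = "msqrt A"
  let ?G = "\<Sum>k\<in>?K. outer (rr_action A ord k) (rr_action A ord k)"
  have lin: "linear ((*v) ?S)" by simp
  have expand: "(\<Sum>j\<in>UNIV. x $ j *\<^sub>R (?S *v axis j 1)) = ?S *v x" for x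
  proof -
    have "?S *v x = ?S *v (\<Sum>j\<in>UNIV. x $ j *\<^sub>R axis j 1)"
      using basis_expansion[of x] by (simp add: scalar_mult_eq_scaleR)
    thus ?thesis by (simp add: linear_sum[OF lin] linear_scale[OF lin])
  qed
  have G: "?G *v u = real m *\<^sub>R (?S *v (?S *v u))" for u
  proof -
    have "?G *v u = (\<Sum>k\<in>?K. ((?S *v u) $ ord (k mod CARD('n))) *\<^sub>R (?S *v axis (ord (k mod CARD('n))) 1))"
      by (simp add: sum_matrix_vector outer_mult rr_action_inner[OF A]) (simp add: rr_action_def)
    also have "\<dots> = (\<Sum>j\<in>UNIV. \<Sum>q<m. ((?S *v u) $ j) *\<^sub>R (?S *v axis j 1))"
      by (rule sum_round_robin[OF ord])
    also have "\<dots> = real m *\<^sub>R (\<Sum>j\<in>UNIV. ((?S *v u) $ j) *\<^sub>R (?S *v axis j 1))"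
      by (simp add: scaleR_right.sum sum_constant_scaleR del: sum_constant)
    finally show ?thesis by (simp only: expand)
  qed
  let ?y = "\<Sum>k\<in>?K. r k *\<^sub>R rr_action A ord k"
  have inj: "x = 0" if "?G *v x = 0" for x
    using that m spd_inj[OF msqrt_spd[OF A]] unfolding G by auto
  have y: "?y = real m *\<^sub>R (?S *v block_avg ord b m r)"
  proof -
    have "?y = (\<Sum>k\<in>?K. r k *\<^sub>R (?S *v axis (ord (k mod CARD('n))) 1))"
      by (simp add: rr_action_def)
    also have "\<dots> = (\<Sum>j\<in>UNIV. \<Sum>q<m. r (CARD('n) * (b + q) + inv_into {..<CARD('n)} ord j) *\<^sub>R (?S *v axis j 1))"
      by (rule sum_round_robin[OF ord])
    also have "\<dots> = (\<Sum>j\<in>UNIV. (real m *\<^sub>R block_avg ord b m r) $ j *\<^sub>R (?S *v axis j 1))"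
      using m by (simp add: block_avg_def scaleR_left.sum)
    also have "\<dots> = ?S *v (real m *\<^sub>R block_avg ord b m r)" by (rule expand)
    finally show ?thesis by (simp add: matrix_vector_mult_scaleR)
  qed
  have "surj ((*v) ?S)"
    using spd_inj[OF msqrt_spd[OF A]] by (simp add: linear_injective_imp_surjective vec.inj_iff_eq_0)
  then obtain u where u: "?S *v u = block_avg ord b m r" by (metis surjD)
  have "ls_est A ord r ?K = matrix_inv ?G *v (?G *v u)"
    unfolding ls_est_def y G u ..
  also have "\<dots> = u" by (rule invertible_matrix_inv_mult) (rule inj)
  finally show ?thesis using u by simp
qed

text \<open>With a = |p|, e = |h - p| and x the component of p along h, a^2 - x^2 is the squared
  distance from p to the line of h, hence at most e^2. If e < a then x > 0, and dividing by a + x >=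
  a makes the loss quadratic in e. Otherwise the trivial bound 2a applies; the case h = 0, where the
  quotient is 0, has e = a and falls here.\<close>

lemma commit_regret:
  fixes p h :: "real^'n"
  assumes "p \<noteq> 0"
  shows "0 \<le> norm p - p \<bullet> h / norm h"
    and "norm p - p \<bullet> h / norm h \<le> (norm (h - p))\<^sup>2 / norm p + (if norm p \<le> norm (h - p) then 2 * norm p else 0)"
proof -
  define a where "a = norm p"
  define e where "e = norm (h - p)"
  have a: "0 < a" using assms by (simp add: a_def)
  have cs: "\<bar>p \<bullet> h / norm h\<bar> \<le> a"
    using Cauchy_Schwarz_ineq2[of p h] by (cases "h = 0") (auto simp: a_def divide_simps)
  thus "0 \<le> norm p - p \<bullet> h / norm h" unfolding a_def by linarith
  show "norm p - p \<bullet> h / norm h \<le> (norm (h - p))\<^sup>2 / norm p + (if norm p \<le> norm (h - p) then 2 * norm p else 0)"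
  proof (cases "a \<le> e")
    case True
    have "0 \<le> e\<^sup>2 / a" using a by simp
    moreover have "a - p \<bullet> h / norm h \<le> 2 * a" using cs by linarith
    ultimately show ?thesis using True unfolding a_def[symmetric] e_def[symmetric] by simp
  next
    case False
    define n where "n = norm h"
    have h0: "h \<noteq> 0" using False by (auto simp: a_def e_def)
    hence n: "0 < n" by (simp add: n_def)
    define x where "x = p \<bullet> h / n"
    have e2: "e\<^sup>2 = n\<^sup>2 - 2 * (x * n) + a\<^sup>2"
      using n by (simp add: e_def a_def n_def x_def power2_norm_eq_inner inner_diff_left inner_diff_right inner_commute)
    have "e\<^sup>2 < a\<^sup>2" using False a by (intro power_strict_mono) (auto simp: e_def)
    hence "n * n < n * (2 * x)" using e2 by (simp add: power2_eq_square algebra_simps)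
    hence x0: "0 < x" using n by simp
    have xa: "x \<le> a" using cs unfolding x_def n_def by linarith
    have "a * (a - x) \<le> (a + x) * (a - x)" using x0 xa by (intro mult_right_mono) auto
    also have "\<dots> = e\<^sup>2 - (n - x)\<^sup>2" unfolding e2 by (simp add: power2_eq_square algebra_simps)
    also have "\<dots> \<le> e\<^sup>2" by simp
    finally have "a - x \<le> e\<^sup>2 / a" using a by (simp add: field_simps)
    thus ?thesis using False unfolding a_def[symmetric] e_def[symmetric] n_def[symmetric] x_def[symmetric] by simp
  qed
qed

section \<open>Subgaussian random variables\<close>

text \<open>Integrability is part of the notion because the integral of a nonintegrable function is
  0 by convention, which would satisfy the inequality vacuously.\<close>

definition subgaussian :: "'a measure \<Rightarrow> real \<Rightarrow> ('a \<Rightarrow> real) \<Rightarrow> bool" where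
  "subgaussian M v X \<longleftrightarrow> X \<in> borel_measurable M \<and>
     (\<forall>l. integrable M (\<lambda>\<omega>. exp (l * X \<omega>)) \<and> (\<integral>\<omega>. exp (l * X \<omega>) \<partial>M) \<le> exp (l\<^sup>2 * v / 2))"

text \<open>In the sum of the cubic Taylor bounds at x and -x the odd terms cancel; the fourth-order
  remainders are nonnegative.\<close>

lemma exp_sum_neg_ge: "x\<^sup>2 \<le> exp x + exp (- x) - 2" for x :: real
proof -
  have *: "1 + x + x\<^sup>2 / 2 + x ^ 3 / 6 \<le> exp x" for x :: real
  proof -
    obtain t where t: "exp x = (\<Sum>m<4. x ^ m / fact m) + exp t / fact 4 * x ^ 4"
      using Maclaurin_exp_le by blast
    have "0 \<le> exp t / fact 4 * x ^ 4" by (intro mult_nonneg_nonneg) auto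
    thus ?thesis unfolding t by (simp add: eval_nat_numeral lessThan_Suc)
  qed
  show ?thesis using *[of x] *[of "- x"] by simp
qed

text \<open>Since l^2 X^2 <= exp(l X) + exp(-l X) - 2, the second moment is at most 2 (exp(l^2 v /
  2) - 1) / l^2 for every l > 0. Letting l tend to 0 gives exactly v, without a loss in the
  constant.\<close>

lemma (in prob_space) subgaussian_second_moment:
  assumes X: "subgaussian M v X"
  shows "integrable M (\<lambda>\<omega>. (X \<omega>)\<^sup>2)" and "(\<integral>\<omega>. (X \<omega>)\<^sup>2 \<partial>M) \<le> v"
proof -
  have [measurable]: "X \<in> borel_measurable M"
    and int: "\<And>l. integrable M (\<lambda>\<omega>. exp (l * X \<omega>))"
    and le: "\<And>l. (\<integral>\<omega>. exp (l * X \<omega>) \<partial>M) \<le> exp (l\<^sup>2 * v / 2)"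
    using X by (auto simp: subgaussian_def)
  have pt: "l\<^sup>2 * (X \<omega>)\<^sup>2 \<le> exp (l * X \<omega>) + exp (- l * X \<omega>) - 2" for l \<omega>
    using exp_sum_neg_ge[of "l * X \<omega>"] by (simp add: power_mult_distrib)
  show int2: "integrable M (\<lambda>\<omega>. (X \<omega>)\<^sup>2)"
  proof (rule Bochner_Integration.integrable_bound)
    show "integrable M (\<lambda>\<omega>. exp (1 * X \<omega>) + exp (- 1 * X \<omega>) - 2)"
      by (intro Bochner_Integration.integrable_add Bochner_Integration.integrable_diff int) auto
    show "AE \<omega> in M. norm ((X \<omega>)\<^sup>2) \<le> norm (exp (1 * X \<omega>) + exp (- 1 * X \<omega>) - 2)"
      using pt[of 1] by (intro AE_I2) (simp add: order_trans[OF _ abs_ge_self])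
  qed auto
  have bound: "(\<integral>\<omega>. (X \<omega>)\<^sup>2 \<partial>M) \<le> 2 * (exp (l\<^sup>2 * v / 2) - 1) / l\<^sup>2" if l: "l > 0" for l
  proof -
    have "(\<integral>\<omega>. l\<^sup>2 * (X \<omega>)\<^sup>2 \<partial>M) \<le> (\<integral>\<omega>. exp (l * X \<omega>) + exp (- l * X \<omega>) - 2 \<partial>M)"
      by (rule integral_mono) (use int2 int[of l] int[of "- l"] pt in auto)
    also have "\<dots> = (\<integral>\<omega>. exp (l * X \<omega>) \<partial>M) + (\<integral>\<omega>. exp (- l * X \<omega>) \<partial>M) - 2"
      using int[of l] int[of "- l"] by (simp add: prob_space)
    also have "\<dots> \<le> exp (l\<^sup>2 * v / 2) + exp (l\<^sup>2 * v / 2) - 2"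
      using le[of l] le[of "-l"] by simp
    finally show ?thesis using l by (simp add: field_simps)
  qed
  have "((\<lambda>l. 2 * (exp (l\<^sup>2 * v / 2) - 1) / l\<^sup>2) \<longlongrightarrow> v) (at_right 0)" by real_asymp
  moreover have "eventually (\<lambda>l. (\<integral>\<omega>. (X \<omega>)\<^sup>2 \<partial>M) \<le> 2 * (exp (l\<^sup>2 * v / 2) - 1) / l\<^sup>2) (at_right 0)"
    using eventually_at_right_less[of 0] by eventually_elim (rule bound)
  ultimately show "(\<integral>\<omega>. (X \<omega>)\<^sup>2 \<partial>M) \<le> v" by (rule tendsto_lowerbound) simp
qed

lemma nn_integral_normal_density:
  assumes "\<sigma> > 0"
  shows "(\<integral>\<^sup>+g. ennreal (normal_density \<mu> \<sigma> g) \<partial>lborel) = 1"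
  using assms by (subst nn_integral_eq_integral) auto

text \<open>Completing the square leaves a constant times the normal density with mean c / (1 - 2t)
  and variance 1 / (1 - 2t).\<close>

lemma nn_integral_std_normal_exp_quadratic:
  assumes "t < 1 / 2"
  shows "(\<integral>\<^sup>+g. ennreal (std_normal_density g * exp (c * g + t * g\<^sup>2)) \<partial>lborel) =
    ennreal (exp (c\<^sup>2 / (2 * (1 - 2 * t))) / sqrt (1 - 2 * t))"
proof -
  define r where "r = 1 - 2 * t"
  have r: "0 < r" using assms by (simp add: r_def)
  define s where "s = 1 / sqrt r"
  have s: "0 < s" and s2: "s\<^sup>2 = 1 / r" using r by (simp_all add: s_def power_divide)
  have "std_normal_density g * exp (c * g + t * g\<^sup>2) =
      exp (c\<^sup>2 / (2 * r)) / sqrt r * normal_density (c / r) s g" for g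
  proof -
    have "- g\<^sup>2 / 2 + (c * g + t * g\<^sup>2) = c\<^sup>2 / (2 * r) + - (g - c / r)\<^sup>2 / (2 * s\<^sup>2)"
    proof -
      have t: "t = (1 - r) / 2" by (simp add: r_def)
      show ?thesis unfolding s2 t using r by (simp add: field_simps power2_eq_square)
    qed
    hence "exp (- g\<^sup>2 / 2) * exp (c * g + t * g\<^sup>2) = exp (c\<^sup>2 / (2 * r)) * exp (- (g - c / r)\<^sup>2 / (2 * s\<^sup>2))"
      by (simp only: exp_add[symmetric])
    moreover have "1 / sqrt (2 * pi) = 1 / sqrt r * (1 / sqrt (2 * pi * s\<^sup>2))"
      unfolding s2 using r by (simp add: real_sqrt_mult real_sqrt_divide)
    ultimately show ?thesis unfolding std_normal_density_def normal_density_def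
      by (simp add: mult_ac)
  qed
  hence "(\<integral>\<^sup>+g. ennreal (std_normal_density g * exp (c * g + t * g\<^sup>2)) \<partial>lborel) =
      (\<integral>\<^sup>+g. ennreal (exp (c\<^sup>2 / (2 * r)) / sqrt r) * ennreal (normal_density (c / r) s g) \<partial>lborel)"
    using r by (simp add: ennreal_mult'[symmetric])
  also have "\<dots> = ennreal (exp (c\<^sup>2 / (2 * r)) / sqrt r)"
    using nn_integral_normal_density[OF s] by (subst nn_integral_cmult) auto
  finally show ?thesis by (simp add: r_def)
qed

text \<open>Writing \<open>exp (l y\<^sup>2)\<close> as a Gaussian average of the exponentials \<open>exp (sqrt (2 l) g y)\<close>
  reduces the squared exponential moment to the ordinary one.\<close>
lemma (in prob_space) subgaussian_exp_square:
  assumes X: "subgaussian M v X" and l: "0 \<le> l" "2 * l * v < 1"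
  shows "(\<integral>\<^sup>+\<omega>. ennreal (exp (l * (x + X \<omega>)\<^sup>2)) \<partial>M) \<le>
    ennreal (exp (l * x\<^sup>2 / (1 - 2 * l * v)) / sqrt (1 - 2 * l * v))"
proof -
  have [measurable]: "X \<in> borel_measurable M"
    and int: "\<And>l. integrable M (\<lambda>\<omega>. exp (l * X \<omega>))"
    and le: "\<And>l. (\<integral>\<omega>. exp (l * X \<omega>) \<partial>M) \<le> exp (l\<^sup>2 * v / 2)"
    using X by (auto simp: subgaussian_def)
  interpret lborel: sigma_finite_measure lborel by (rule sigma_finite_lborel)
  interpret P: pair_sigma_finite M lborel ..
  define c where "c = sqrt (2 * l)"
  have c2: "c\<^sup>2 = 2 * l" using l by (simp add: c_def)
  have "ennreal (exp (l * y\<^sup>2)) = (\<integral>\<^sup>+g. ennreal (std_normal_density g * exp (c * y * g)) \<partial>lborel)" for y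
    using nn_integral_std_normal_exp_quadratic[of 0 "c * y"] by (simp add: power_mult_distrib c2)
  hence "(\<integral>\<^sup>+\<omega>. ennreal (exp (l * (x + X \<omega>)\<^sup>2)) \<partial>M) =
      (\<integral>\<^sup>+\<omega>. (\<integral>\<^sup>+g. ennreal (std_normal_density g * exp (c * (x + X \<omega>) * g)) \<partial>lborel) \<partial>M)" by simp
  also have "\<dots> = (\<integral>\<^sup>+g. (\<integral>\<^sup>+\<omega>. ennreal (std_normal_density g * exp (c * (x + X \<omega>) * g)) \<partial>M) \<partial>lborel)"
    by (rule P.Fubini'[symmetric]) measurable
  also have "\<dots> \<le> (\<integral>\<^sup>+g. ennreal (std_normal_density g * exp (c * x * g + l * v * g\<^sup>2)) \<partial>lborel)"
  proof (rule nn_integral_mono)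
    fix g :: real
    have "(\<integral>\<^sup>+\<omega>. ennreal (std_normal_density g * exp (c * (x + X \<omega>) * g)) \<partial>M) =
        (\<integral>\<^sup>+\<omega>. ennreal (std_normal_density g * exp (c * x * g)) * ennreal (exp (c * g * X \<omega>)) \<partial>M)"
      by (simp add: ennreal_mult'[symmetric] exp_add[symmetric] algebra_simps)
    also have "\<dots> = ennreal (std_normal_density g * exp (c * x * g)) * (\<integral>\<^sup>+\<omega>. ennreal (exp (c * g * X \<omega>)) \<partial>M)"
      by (rule nn_integral_cmult) measurable
    also have "(\<integral>\<^sup>+\<omega>. ennreal (exp (c * g * X \<omega>)) \<partial>M) = ennreal (\<integral>\<omega>. exp (c * g * X \<omega>) \<partial>M)"
      by (rule nn_integral_eq_integral[OF int]) auto
    also have "ennreal (std_normal_density g * exp (c * x * g)) * ennreal (\<integral>\<omega>. exp (c * g * X \<omega>) \<partial>M)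
        \<le> ennreal (std_normal_density g * exp (c * x * g)) * ennreal (exp (l * v * g\<^sup>2))"
      using le[of "c * g"] by (intro mult_left_mono ennreal_leI) (simp_all add: power_mult_distrib c2 mult_ac)
    also have "\<dots> = ennreal (std_normal_density g * exp (c * x * g + l * v * g\<^sup>2))"
      by (simp add: ennreal_mult'[symmetric] exp_add mult.assoc)
    finally show "(\<integral>\<^sup>+\<omega>. ennreal (std_normal_density g * exp (c * (x + X \<omega>) * g)) \<partial>M)
        \<le> ennreal (std_normal_density g * exp (c * x * g + l * v * g\<^sup>2))" .
  qed
  also have "\<dots> = ennreal (exp ((c * x)\<^sup>2 / (2 * (1 - 2 * (l * v)))) / sqrt (1 - 2 * (l * v)))"
    using l by (intro nn_integral_std_normal_exp_quadratic) simp
  also have "(c * x)\<^sup>2 / (2 * D) = l * x\<^sup>2 / D" for D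
    by (simp add: power_mult_distrib c2)
  finally show ?thesis by (simp add: mult.assoc)
qed

lemma (in prob_space) subgaussian_weighted_sum:
  assumes I: "finite I" and ind: "indep_vars (\<lambda>_. borel) X I"
    and sg: "\<And>i. i \<in> I \<Longrightarrow> subgaussian M v (X i)"
  shows "subgaussian M ((\<Sum>i\<in>I. (c i)\<^sup>2) * v) (\<lambda>\<omega>. \<Sum>i\<in>I. c i * X i \<omega>)"
proof -
  have meas: "X i \<in> borel_measurable M" if "i \<in> I" for i using sg[OF that] by (simp add: subgaussian_def)
  have int: "integrable M (\<lambda>\<omega>. exp (l * X i \<omega>))" if "i \<in> I" for i l
    using sg[OF that] by (simp add: subgaussian_def)
  have le: "(\<integral>\<omega>. exp (l * X i \<omega>) \<partial>M) \<le> exp (l\<^sup>2 * v / 2)" if "i \<in> I" for i l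
    using sg[OF that] by (simp add: subgaussian_def)
  have e: "exp (l * (\<Sum>i\<in>I. c i * X i \<omega>)) = (\<Prod>i\<in>I. exp ((l * c i) * X i \<omega>))" for l \<omega>
    using I by (simp add: sum_distrib_left exp_sum mult.assoc)
  have ind': "indep_vars (\<lambda>_. borel) (\<lambda>i \<omega>. exp ((l * c i) * X i \<omega>)) I" for l
    by (rule indep_vars_compose2[OF ind]) auto
  show ?thesis unfolding subgaussian_def
  proof (intro conjI allI)
    show "(\<lambda>\<omega>. \<Sum>i\<in>I. c i * X i \<omega>) \<in> borel_measurable M" using meas by auto
    fix l
    show "integrable M (\<lambda>\<omega>. exp (l * (\<Sum>i\<in>I. c i * X i \<omega>)))"
      unfolding e by (rule indep_vars_integrable[OF I ind']) (rule int)
    have "(\<integral>\<omega>. exp (l * (\<Sum>i\<in>I. c i * X i \<omega>)) \<partial>M) = (\<Prod>i\<in>I. \<integral>\<omega>. exp ((l * c i) * X i \<omega>) \<partial>M)"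
      unfolding e by (rule indep_vars_lebesgue_integral[OF I ind']) (rule int)
    also have "\<dots> \<le> (\<Prod>i\<in>I. exp ((l * c i)\<^sup>2 * v / 2))"
      by (rule prod_mono) (simp add: le)
    also have "\<dots> = exp (\<Sum>i\<in>I. (l * c i)\<^sup>2 * v / 2)" using I by (simp add: exp_sum)
    also have "(\<Sum>i\<in>I. (l * c i)\<^sup>2 * v / 2) = l\<^sup>2 * ((\<Sum>i\<in>I. (c i)\<^sup>2) * v) / 2"
      by (simp add: sum_distrib_left sum_distrib_right sum_divide_distrib power_mult_distrib mult_ac)
    finally show "(\<integral>\<omega>. exp (l * (\<Sum>i\<in>I. c i * X i \<omega>)) \<partial>M) \<le> exp (l\<^sup>2 * ((\<Sum>i\<in>I. (c i)\<^sup>2) * v) / 2)" .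
  qed
qed

text \<open>Distinct exploration steps use disjoint pairs of rounds, whence independence; weights 1
  and -1 on a pair add the two variance proxies.\<close>

lemma (in prob_space) paired_difference:
  fixes z :: "nat \<Rightarrow> 'a \<Rightarrow> real"
  assumes ind: "indep_vars (\<lambda>_. borel) z UNIV" and sg: "\<And>t. subgaussian M v (z t)"
  shows indep_paired_difference: "indep_vars (\<lambda>_. borel) (\<lambda>k \<omega>. z (2 * k + 2) \<omega> - z (2 * k + 1) \<omega>) UNIV"
    and subgaussian_paired_difference: "subgaussian M (2 * v) (\<lambda>\<omega>. z (2 * k + 2) \<omega> - z (2 * k + 1) \<omega>)"
proof -
  define K where "K k = {2 * k + 1, 2 * k + 2}" for k :: nat
  have dis: "disjoint_family_on K UNIV" unfolding disjoint_family_on_def K_def by auto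
  have "indep_vars (\<lambda>_. borel) (\<lambda>k \<omega>. (\<lambda>f. f (2 * k + 2) - f (2 * k + 1)) (restrict (\<lambda>i. z i \<omega>) (K k))) UNIV"
    by (rule indep_vars_compose2[OF indep_vars_restrict[OF ind _ dis]]) (auto simp: K_def)
  thus "indep_vars (\<lambda>_. borel) (\<lambda>k \<omega>. z (2 * k + 2) \<omega> - z (2 * k + 1) \<omega>) UNIV"
    by (simp add: K_def)
  have "indep_vars (\<lambda>_. borel) z (K k)" by (rule indep_vars_subset[OF ind]) simp
  from subgaussian_weighted_sum[OF _ this sg, of "\<lambda>i. if even i then 1 else -1"]
  show "subgaussian M (2 * v) (\<lambda>\<omega>. z (2 * k + 2) \<omega> - z (2 * k + 1) \<omega>)"
    by (simp add: K_def algebra_simps)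
qed

section \<open>Noise of a block: coordinates, moments, tails, independence of the past\<close>

lemma block_avg_restrict:
  assumes ord: "bij_betw ord {..<CARD('n)} (UNIV :: 'n set)"
    and N: "N0 \<le> CARD('n) * b" "CARD('n) * (b + m) \<le> N"
  shows "block_avg ord b m (restrict f {N0..<N}) = (block_avg ord b m f :: real^'n)"
    and "\<And>q j. q < m \<Longrightarrow> CARD('n) * (b + q) + inv_into {..<CARD('n)} ord j \<in> {N0..<N}"
proof -
  show in_range: "CARD('n) * (b + q) + inv_into {..<CARD('n)} ord j \<in> {N0..<N}" if "q < m" for q j
  proof -
    have "inv_into {..<CARD('n)} ord j < CARD('n)"
      using ord inv_into_into[of j ord "{..<CARD('n)}"] by (auto simp: bij_betw_def)
    moreover have "CARD('n) * (b + q) + CARD('n) \<le> CARD('n) * (b + m)"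
      using that mult_le_mono2[of "b + q + 1" "b + m" "CARD('n)"] by (simp add: algebra_simps)
    ultimately show ?thesis using N by (simp add: algebra_simps)
  qed
  show "block_avg ord b m (restrict f {N0..<N}) = (block_avg ord b m f :: real^'n)"
    unfolding block_avg_def using in_range by (simp add: vec_eq_iff)
qed

text \<open>Independence is available for restrictions of the noise to disjoint index sets, so a
  block average must be a measurable function on the product space over its own window of
  steps.\<close>

lemma block_avg_measurable:
  assumes ord: "bij_betw ord {..<CARD('n)} (UNIV :: 'n set)"
    and N: "N0 \<le> CARD('n) * b" "CARD('n) * (b + m) \<le> N"
  shows "(block_avg ord b m :: _ \<Rightarrow> real^'n) \<in> PiM {N0..<N} (\<lambda>_. borel) \<rightarrow>\<^sub>M borel"
proof (subst borel_measurable_euclidean_space, rule ballI)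
  fix i :: "real^'n" assume "i \<in> Basis"
  then obtain j where j: "i = axis j 1" by (auto simp: Basis_vec_def)
  have "(\<lambda>f. (\<Sum>q<m. f (CARD('n) * (b + q) + inv_into {..<CARD('n)} ord j)) / real m)
      \<in> borel_measurable (PiM {N0..<N} (\<lambda>_. borel))"
    by (intro borel_measurable_divide borel_measurable_sum measurable_component_singleton
        block_avg_restrict(2)[OF ord N]) auto
  thus "(\<lambda>f. block_avg ord b m f \<bullet> i) \<in> borel_measurable (PiM {N0..<N} (\<lambda>_. borel))"
    by (simp add: j inner_axis block_avg_def)
qed

lemma block_avg_add:
  "0 < m \<Longrightarrow> (\<And>k. r k = p $ ord (k mod CARD('n)) + w k) \<Longrightarrow> bij_betw ord {..<CARD('n)} UNIV \<Longrightarrow>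
    block_avg ord b m r = p + (block_avg ord b m w :: real^'n)"
proof -
  assume m: "0 < m" and r: "\<And>k. r k = p $ ord (k mod CARD('n)) + w k"
    and ord: "bij_betw ord {..<CARD('n)} UNIV"
  have *: "inv_into {..<CARD('n)} ord j mod CARD('n) = inv_into {..<CARD('n)} ord j"
    "ord (inv_into {..<CARD('n)} ord j) = j" for j
  proof -
    have "inv_into {..<CARD('n)} ord j \<in> {..<CARD('n)}" "ord (inv_into {..<CARD('n)} ord j) = j"
      using ord inv_into_into[of j ord "{..<CARD('n)}"] f_inv_into_f[of j ord "{..<CARD('n)}"]
      by (auto simp: bij_betw_def)
    thus "inv_into {..<CARD('n)} ord j mod CARD('n) = inv_into {..<CARD('n)} ord j"
      "ord (inv_into {..<CARD('n)} ord j) = j" by simp_all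
  qed
  show ?thesis using m by (simp add: block_avg_def vec_eq_iff r * sum.distrib add_divide_distrib)
qed

locale subgaussian_noise = prob_space M for M :: "'a measure" +
  fixes w :: "nat \<Rightarrow> 'a \<Rightarrow> real" and v :: real and ord :: "nat \<Rightarrow> 'n::finite"
  assumes indep: "indep_vars (\<lambda>_. borel) w UNIV" and sg: "\<And>k. subgaussian M v (w k)"
    and ord: "bij_betw ord {..<CARD('n)} UNIV"
begin

definition noise :: "nat \<Rightarrow> nat \<Rightarrow> 'a \<Rightarrow> real^'n" where
  "noise b m \<omega> = block_avg ord b m (\<lambda>k. w k \<omega>)"

lemma w_measurable [measurable]: "w k \<in> borel_measurable M"
  using sg by (simp add: subgaussian_def)

lemma noise_eq_restrict:
  "N0 \<le> CARD('n) * b \<Longrightarrow> CARD('n) * (b + m) \<le> N \<Longrightarrow>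
    noise b m \<omega> = block_avg ord b m (restrict (\<lambda>k. w k \<omega>) {N0..<N})"
  using block_avg_restrict(1)[OF ord] by (simp add: noise_def)

lemma noise_measurable [measurable]: "noise b m \<in> borel_measurable M"
proof -
  have "(\<lambda>\<omega>. block_avg ord b m (restrict (\<lambda>k. w k \<omega>) {0..<CARD('n) * (b + m)}) :: real^'n) \<in> borel_measurable M"
    by (rule measurable_compose[OF _ block_avg_measurable[OF ord]])
       (auto intro!: measurable_restrict)
  thus ?thesis by (simp add: noise_eq_restrict[symmetric] cong: measurable_cong)
qed

text \<open>Coordinate j averages the m steps k with \<open>ord (k mod d)\<close> equal to j, where
  d is the dimension. These index sets are disjoint for distinct j, and averaging m independent
  terms divides the variance proxy by m.\<close>

lemma noise_coordinate:
  assumes m: "0 < m"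
  shows indep_noise_coordinates: "indep_vars (\<lambda>_. borel) (\<lambda>j \<omega>. noise b m \<omega> $ j) UNIV"
    and subgaussian_noise_coordinate: "subgaussian M (v / m) (\<lambda>\<omega>. noise b m \<omega> $ j)"
proof -
  let ?g = "\<lambda>j q. CARD('n) * (b + q) + inv_into {..<CARD('n)} ord j"
  have idx: "inv_into {..<CARD('n)} ord j < CARD('n)" "ord (inv_into {..<CARD('n)} ord j) = j" for j
      using ord inv_into_into[of j ord "{..<CARD('n)}"] f_inv_into_f[of j ord "{..<CARD('n)}"]
      by (auto simp: bij_betw_def)
  have g_mod: "ord (?g j q mod CARD('n)) = j" for j q using idx by simp
  define K where "K j = ?g j ` {..<m}" for j
  have inj: "inj_on (?g j) {..<m}" for j by (auto simp: inj_on_def)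
  have dis: "disjoint_family_on K UNIV"
    unfolding disjoint_family_on_def K_def using g_mod by (metis (no_types, lifting) disjoint_iff imageE)
  have nc: "noise b m \<omega> $ j = (\<Sum>k\<in>K j. (1 / real m) * w k \<omega>)" for j \<omega>
    unfolding noise_def block_avg_def K_def by (simp add: sum.reindex[OF inj] sum_divide_distrib)
  have "indep_vars (\<lambda>_. borel) (\<lambda>j \<omega>. (\<lambda>f. \<Sum>k\<in>K j. (1 / real m) * f k) (restrict (\<lambda>i. w i \<omega>) (K j))) UNIV"
    by (rule indep_vars_compose2[OF indep_vars_restrict[OF indep _ dis]])
       (auto intro!: borel_measurable_sum borel_measurable_times measurable_component_singleton)
  thus "indep_vars (\<lambda>_. borel) (\<lambda>j \<omega>. noise b m \<omega> $ j) UNIV"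
    unfolding nc by simp
  have "indep_vars (\<lambda>_. borel) w (K j)" by (rule indep_vars_subset[OF indep]) simp
  from subgaussian_weighted_sum[OF _ this sg, of "\<lambda>_. 1 / real m"]
  have "subgaussian M ((\<Sum>k\<in>K j. (1 / real m)\<^sup>2) * v) (\<lambda>\<omega>. noise b m \<omega> $ j)"
    unfolding nc by (simp add: K_def)
  moreover have "card (K j) = m" by (simp add: K_def card_image[OF inj])
  ultimately show "subgaussian M (v / m) (\<lambda>\<omega>. noise b m \<omega> $ j)"
    using m by (simp add: power2_eq_square)
qed

lemma norm_sq_vec: "(norm x)\<^sup>2 = (\<Sum>j\<in>UNIV. (x $ j)\<^sup>2)" for x :: "real^'n"
  by (simp add: norm_vec_def L2_set_def sum_nonneg)

lemma noise_second_moment: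
  assumes m: "0 < m"
  shows "integrable M (\<lambda>\<omega>. (norm (noise b m \<omega>))\<^sup>2)"
    and "(\<integral>\<omega>. (norm (noise b m \<omega>))\<^sup>2 \<partial>M) \<le> CARD('n) * v / m"
proof -
  note sgc = subgaussian_second_moment[OF subgaussian_noise_coordinate[OF m]]
  show "integrable M (\<lambda>\<omega>. (norm (noise b m \<omega>))\<^sup>2)"
    unfolding norm_sq_vec by (intro Bochner_Integration.integrable_sum sgc)
  have "(\<integral>\<omega>. (norm (noise b m \<omega>))\<^sup>2 \<partial>M) = (\<Sum>j\<in>UNIV. \<integral>\<omega>. (noise b m \<omega> $ j)\<^sup>2 \<partial>M)"
    unfolding norm_sq_vec by (intro Bochner_Integration.integral_sum sgc)
  also have "\<dots> \<le> (\<Sum>j\<in>(UNIV::'n set). v / m)" by (intro sum_mono sgc)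
  finally show "(\<integral>\<omega>. (norm (noise b m \<omega>))\<^sup>2 \<partial>M) \<le> CARD('n) * v / m" by simp
qed

text \<open>A Chernoff bound for the squared norm: its exponential moment factors over the
  independent coordinates into the squared exponential moments of
  \<open>subgaussian_exp_square\<close>. The mean p is kept, which inflates |p|^2 by 1 / (1 - 2 l v
  / m).\<close>

lemma noise_tail:
  assumes m: "0 < m" and l: "0 \<le> l" "2 * l * (v / m) < 1"
  shows "prob {\<omega> \<in> space M. R \<le> (norm (p + noise b m \<omega>))\<^sup>2} \<le>
    exp (l * (norm p)\<^sup>2 / (1 - 2 * l * (v / m)) - l * R) / sqrt (1 - 2 * l * (v / m)) ^ CARD('n)"
proof -
  let ?D = "1 - 2 * l * (v / m)"
  let ?E = "{\<omega> \<in> space M. R \<le> (norm (p + noise b m \<omega>))\<^sup>2}"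
  have e: "exp (l * (norm (p + noise b m \<omega>))\<^sup>2) = (\<Prod>j\<in>UNIV. exp (l * (p $ j + noise b m \<omega> $ j)\<^sup>2))" for \<omega>
    unfolding norm_sq_vec by (simp add: sum_distrib_left exp_sum)
  have "(\<integral>\<^sup>+\<omega>. ennreal (exp (l * (norm (p + noise b m \<omega>))\<^sup>2)) \<partial>M) =
      (\<integral>\<^sup>+\<omega>. (\<Prod>j\<in>UNIV. ennreal (exp (l * (p $ j + noise b m \<omega> $ j)\<^sup>2))) \<partial>M)"
    unfolding e by (simp add: prod_ennreal)
  also have "\<dots> = (\<Prod>j\<in>UNIV. \<integral>\<^sup>+\<omega>. ennreal (exp (l * (p $ j + noise b m \<omega> $ j)\<^sup>2)) \<partial>M)"
    by (rule indep_vars_nn_integral) (auto intro!: indep_vars_compose2[OF indep_noise_coordinates[OF m]])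
  also have "\<dots> \<le> (\<Prod>j\<in>UNIV. ennreal (exp (l * (p $ j)\<^sup>2 / ?D) / sqrt ?D))"
    by (intro prod_mono_ennreal subgaussian_exp_square subgaussian_noise_coordinate m l)
  also have "\<dots> = ennreal (\<Prod>j\<in>UNIV. exp (l * (p $ j)\<^sup>2 / ?D) / sqrt ?D)"
    using l by (intro prod_ennreal) simp
  also have "(\<Prod>j\<in>UNIV. exp (l * (p $ j)\<^sup>2 / ?D) / sqrt ?D) = exp (l * (norm p)\<^sup>2 / ?D) / sqrt ?D ^ CARD('n)"
    unfolding norm_sq_vec by (simp add: prod_dividef exp_sum[symmetric] sum_distrib_left sum_divide_distrib)
  finally have bd: "(\<integral>\<^sup>+\<omega>. ennreal (exp (l * (norm (p + noise b m \<omega>))\<^sup>2)) \<partial>M) \<le>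
      ennreal (exp (l * (norm p)\<^sup>2 / ?D) / sqrt ?D ^ CARD('n))" .
  have "ennreal (exp (l * R) * prob ?E) = ennreal (exp (l * R)) * emeasure M ?E"
    by (simp add: emeasure_eq_measure ennreal_mult')
  also have "\<dots> = (\<integral>\<^sup>+\<omega>. ennreal (exp (l * R)) * indicator ?E \<omega> \<partial>M)"
    by (rule nn_integral_cmult_indicator[symmetric]) measurable
  also have "\<dots> \<le> (\<integral>\<^sup>+\<omega>. ennreal (exp (l * (norm (p + noise b m \<omega>))\<^sup>2)) \<partial>M)"
    using l by (intro nn_integral_mono) (auto simp: indicator_def intro!: mult_left_mono)
  also note bd
  finally have "exp (l * R) * prob ?E \<le> exp (l * (norm p)\<^sup>2 / ?D) / sqrt ?D ^ CARD('n)"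
    using l by (subst (asm) ennreal_le_iff) auto
  hence "prob ?E \<le> exp (l * (norm p)\<^sup>2 / ?D) / sqrt ?D ^ CARD('n) / exp (l * R)"
    by (subst pos_le_divide_eq) (simp_all only: exp_gt_zero mult.commute)
  thus ?thesis by (simp only: exp_diff divide_divide_eq_left mult.commute)
qed

text \<open>The steps before the block and those of the block are disjoint index sets.
  \<open>Q\<close> enters as an indicator on the product over the earlier steps, and
  \<open>Q_restrict\<close> says that it reads nothing else; independence then factors the
  expectation.\<close>

lemma noise_indep_of_past:
  assumes Q: "Measurable.pred (PiM {0..<CARD('n) * b} (\<lambda>_. borel)) Q"
    and Q_restrict: "\<And>f. Q (restrict f {0..<CARD('n) * b}) \<longleftrightarrow> Q f"
    and \<phi>: "\<phi> \<in> borel_measurable borel" and int: "integrable M (\<lambda>\<omega>. \<phi> (noise b m \<omega>))"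
  defines "D \<equiv> {\<omega> \<in> space M. Q (\<lambda>k. w k \<omega>)}"
  shows "D \<in> sets M" and "integrable M (\<lambda>\<omega>. indicator D \<omega> * \<phi> (noise b m \<omega>) :: real)"
    and "(\<integral>\<omega>. indicator D \<omega> * \<phi> (noise b m \<omega>) \<partial>M) = prob D * (\<integral>\<omega>. \<phi> (noise b m \<omega>) \<partial>M)"
proof -
  let ?A = "{0..<CARD('n) * b}" and ?B = "{CARD('n) * b..<CARD('n) * (b + m)}"
  let ?G = "\<lambda>f. indicator {f. Q f} f :: real"
  have [measurable]: "(\<lambda>\<omega>. restrict (\<lambda>k. w k \<omega>) ?A) \<in> M \<rightarrow>\<^sub>M PiM ?A (\<lambda>_. borel)"
    by (auto intro!: measurable_restrict)
  have D_eq: "D = {\<omega> \<in> space M. Q (restrict (\<lambda>k. w k \<omega>) ?A)}" by (simp add: D_def Q_restrict)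
  show D: "D \<in> sets M" unfolding D_eq using Q by measurable
  have G: "?G \<in> borel_measurable (PiM ?A (\<lambda>_. borel))"
    using Q by measurable
  have "indep_var borel (?G \<circ> (\<lambda>\<omega>. restrict (\<lambda>k. w k \<omega>) ?A))
      borel ((\<phi> \<circ> block_avg ord b m) \<circ> (\<lambda>\<omega>. restrict (\<lambda>k. w k \<omega>) ?B))"
    by (rule indep_var_compose[OF indep_var_restrict[OF indep] G])
       (auto intro!: measurable_comp[OF block_avg_measurable[OF ord] \<phi>])
  hence ind: "indep_var borel (?G \<circ> (\<lambda>\<omega>. restrict (\<lambda>k. w k \<omega>) ?A)) borel (\<lambda>\<omega>. \<phi> (noise b m \<omega>))"
    by (simp add: comp_def noise_eq_restrict[symmetric])
  have GD: "(?G \<circ> (\<lambda>\<omega>. restrict (\<lambda>k. w k \<omega>) ?A)) \<omega> = indicator D \<omega>" if "\<omega> \<in> space M" for \<omega>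
    using that by (simp add: D_eq indicator_def)
  have intG: "integrable M (?G \<circ> (\<lambda>\<omega>. restrict (\<lambda>k. w k \<omega>) ?A))"
    by (rule Bochner_Integration.integrable_cong[THEN iffD2, OF refl GD])
       (use D in \<open>auto simp: emeasure_eq_measure\<close>)
  have "integrable M (\<lambda>\<omega>. (?G \<circ> (\<lambda>\<omega>. restrict (\<lambda>k. w k \<omega>) ?A)) \<omega> * \<phi> (noise b m \<omega>))"
    by (rule indep_var_integrable[OF ind intG int])
  thus "integrable M (\<lambda>\<omega>. indicator D \<omega> * \<phi> (noise b m \<omega>) :: real)"
    by (rule Bochner_Integration.integrable_cong[THEN iffD1, rotated -1]) (simp_all only: GD)
  have "(\<integral>\<omega>. indicator D \<omega> * \<phi> (noise b m \<omega>) \<partial>M) =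
      (\<integral>\<omega>. (?G \<circ> (\<lambda>\<omega>. restrict (\<lambda>k. w k \<omega>) ?A)) \<omega> * \<phi> (noise b m \<omega>) \<partial>M)"
    by (rule Bochner_Integration.integral_cong) (simp_all only: GD)
  also have "\<dots> = (\<integral>\<omega>. (?G \<circ> (\<lambda>\<omega>. restrict (\<lambda>k. w k \<omega>) ?A)) \<omega> \<partial>M) * (\<integral>\<omega>. \<phi> (noise b m \<omega>) \<partial>M)"
    by (rule indep_var_lebesgue_integral[OF ind intG int])
  also have "(\<integral>\<omega>. (?G \<circ> (\<lambda>\<omega>. restrict (\<lambda>k. w k \<omega>) ?A)) \<omega> \<partial>M) = (\<integral>\<omega>. indicator D \<omega> \<partial>M)"
    by (rule Bochner_Integration.integral_cong) (simp_all only: GD)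
  also have "\<dots> = prob D" using D by simp
  finally show "(\<integral>\<omega>. indicator D \<omega> * \<phi> (noise b m \<omega>) \<partial>M) = prob D * (\<integral>\<omega>. \<phi> (noise b m \<omega>) \<partial>M)" .
qed

end

section \<open>Regret along a sample path\<close>

text \<open>No probability enters here: the noise of the paired differences is an arbitrary fixed
  sequence \<open>f\<close>, so the run of the algorithm and its regret are deterministic functions
  of \<open>f\<close>.\<close>

locale ellipsoid_bandit =
  fixes A :: "real^'n^'n" and c \<theta> :: "real^'n" and \<sigma> :: real and T :: nat
    and ord :: "nat \<Rightarrow> 'n"
  assumes card2: "CARD('n) \<ge> 2" and \<sigma>: "\<sigma> > 0" and A: "spd A"
    and ord_bij: "bij_betw ord {..<CARD('n)} UNIV" and \<theta>: "\<theta> \<noteq> 0" and T: "T \<ge> 1"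
begin

definition p :: "real^'n" where "p = msqrt A *v \<theta>"
definition a :: real where "a = norm p"

definition \<delta> :: "nat \<Rightarrow> real" where
  "\<delta> i = delta_i CARD('n) (real T / 2) (blk_len CARD('n) i)"

definition U :: "nat \<Rightarrow> real" where
  "U i = Ufun (2 * \<sigma>\<^sup>2) CARD('n) (\<delta> i) (blk_len CARD('n) i)"

definition rewards :: "(nat \<Rightarrow> real) \<Rightarrow> nat \<Rightarrow> real" where
  "rewards f k = p $ ord (k mod CARD('n)) + f k"

text \<open>Block \<open>i\<close> is preceded by \<open>2 ^ (i - 1) - 1\<close> round-robin cycles and consists of \<open>2 ^ (i - 1)\<close> cycles.\<close>
definition Bhat :: "(nat \<Rightarrow> real) \<Rightarrow> nat \<Rightarrow> real" where
  "Bhat f i = norm (p + block_avg ord (2 ^ (i - 1) - 1) (2 ^ (i - 1)) f)"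

definition run :: "(nat \<Rightarrow> real) \<Rightarrow> (nat \<times> (real^'n)) option" where
  "run f = e2tc A ord (2 * \<sigma>\<^sup>2) (real T / 2) 3 (rewards f)"

definition regret :: "(nat \<Rightarrow> real) \<Rightarrow> nat \<Rightarrow> real" where
  "regret f t = (x_star A c \<theta> - reduction_action c A ord (2 * \<sigma>\<^sup>2) (real T / 2) 3 (rewards f) t) \<bullet> \<theta>"

text \<open>Bounds the regret of one committed round in terms of the Phase 2 noise: the first summand
  suffices when the committed direction makes an acute angle with \<open>p\<close>.\<close>
definition loss :: "real^'n \<Rightarrow> real" where
  "loss x = (norm x)\<^sup>2 / a + (if a \<le> norm x then 2 * a else 0)"

definition overestimates :: "(nat \<Rightarrow> real) \<Rightarrow> nat \<Rightarrow> bool" where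
  "overestimates f i \<longleftrightarrow> 3 * U i \<le> Bhat f i \<and> 3 * a / 2 \<le> Bhat f i"

definition deviates :: "(nat \<Rightarrow> real) \<Rightarrow> nat \<Rightarrow> bool" where
  "deviates f i \<longleftrightarrow> 2 * U i \<le> norm (block_avg ord (2 ^ (i - 1) - 1) (2 ^ (i - 1)) f :: real^'n)"

text \<open>\<open>m\<close> is the number of round-robin cycles of Phase 2, so that \<open>N\<^sub>e = d m\<close>.\<close>
definition stops :: "(nat \<Rightarrow> real) \<Rightarrow> nat \<Rightarrow> nat \<Rightarrow> bool" where
  "stops f i m \<longleftrightarrow> 3 * U i < Bhat f i \<and> (\<forall>j\<in>{1..<i}. \<not> 3 * U j < Bhat f j) \<and>
     nat \<lceil>\<sigma> * sqrt (real T) / Bhat f i\<rceil> = m \<and> 3 * a / 5 \<le> Bhat f i \<and> Bhat f i \<le> 3 * a / 2"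

lemma normM_\<theta>: "normM A \<theta> = a"
  by (simp add: normM_msqrt[OF A] a_def p_def)

lemma a_pos: "0 < a"
  using spd_inj[OF msqrt_spd[OF A], of \<theta>] \<theta> by (auto simp: a_def p_def)

lemma p_nz: "p \<noteq> 0" using a_pos by (auto simp: a_def)

lemma blk_len_pos: "0 < blk_len CARD('n) i" by (simp add: blk_len_def)

lemma \<delta>_bounds: "0 < \<delta> i" "\<delta> i \<le> 1"
  using T blk_len_pos[of i] by (auto simp: \<delta>_def delta_i_def)

lemma U_pos: "0 < U i"
proof -
  have "0 \<le> ln (1 / \<delta> i)"
    using \<delta>_bounds[of i] by (intro ln_ge_zero) simp
  thus ?thesis unfolding U_def Ufun_def using \<sigma> blk_len_pos[of i]
    by (intro real_sqrt_gt_zero mult_pos_pos divide_pos_pos add_pos_nonneg) auto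
qed

lemma blk_start_eq: "1 \<le> i \<Longrightarrow> blk_start CARD('n) i = CARD('n) * (2 ^ (i - 1) - 1)"
proof (induction i rule: dec_induct)
  case (step i)
  have "blk_start CARD('n) (Suc i) = blk_start CARD('n) i + CARD('n) * 2 ^ (i - 1)"
    using step(1) by (simp add: blk_start_def blk_len_def atLeastLessThanSuc)
  also have "\<dots> = CARD('n) * (2 ^ i - 1)"
  proof -
    have "(2::nat) ^ i = 2 * 2 ^ (i - 1)" using step(1) by (simp add: power_Suc[symmetric] del: power_Suc)
    moreover have "(1::nat) \<le> 2 ^ (i - 1)" by simp
    ultimately have "(2 ^ (i - 1) - 1) + 2 ^ (i - 1) = (2::nat) ^ i - 1" by linarith
    thus ?thesis using step.IH by (metis distrib_left)
  qed
  finally show ?case by simp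
qed (simp add: blk_start_def)

lemma blk_end_eq:
  assumes "1 \<le> i"
  shows "blk_start CARD('n) i + blk_len CARD('n) i = CARD('n) * (2 ^ i - 1)"
proof -
  have "(2::nat) ^ i = 2 * 2 ^ (i - 1)" using assms by (simp add: power_Suc[symmetric] del: power_Suc)
  moreover have "(1::nat) \<le> 2 ^ (i - 1)" by simp
  ultimately have "(2 ^ (i - 1) - 1) + 2 ^ (i - 1) = (2::nat) ^ i - 1" by linarith
  thus ?thesis unfolding blk_start_eq[OF assms] blk_len_def by (metis distrib_left)
qed

lemma msqrt_ls_est_rewards:
  "0 < m \<Longrightarrow> msqrt A *v ls_est A ord (rewards f) {CARD('n) * b..<CARD('n) * b + CARD('n) * m} =
    p + block_avg ord b m f"
  by (simp add: msqrt_ls_est[OF A ord_bij]) (rule block_avg_add[OF _ _ ord_bij], simp_all add: rewards_def)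

lemma normM_phase1_est:
  assumes "1 \<le> i"
  shows "normM A (phase1_est A ord (rewards f) i) = Bhat f i"
  unfolding phase1_est_def normM_msqrt[OF A] Bhat_def blk_start_eq[OF assms] blk_len_def
  by (simp add: msqrt_ls_est_rewards)

lemma phase1_stop_iff:
  "1 \<le> i \<Longrightarrow> phase1_stop A ord (2 * \<sigma>\<^sup>2) (real T / 2) 3 (rewards f) i \<longleftrightarrow> 3 * U i < Bhat f i"
  by (simp add: phase1_stop_def normM_phase1_est U_def \<delta>_def)

text \<open>The doubled variance proxy and the halved horizon cancel, so the length of Phase 2 is
  governed by \<sigma> and T as if there were no reduction.\<close>

lemma sqrt_horizon: "sqrt (2 * \<sigma>\<^sup>2) * sqrt (real T / 2) = \<sigma> * sqrt (real T)"
  using \<sigma> by (simp add: real_sqrt_mult real_sqrt_divide)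

lemma commit_inner:
  "(1 / normM A th) *\<^sub>R (A *v th) \<bullet> \<theta> = p \<bullet> (msqrt A *v th) / norm (msqrt A *v th)"
  unfolding inner_scaleR_left inner_spd_msqrt[OF A] normM_msqrt[OF A] p_def
  by (simp add: inner_commute[of "msqrt A *v \<theta>"])

lemma x_star_inner: "x_star A c \<theta> \<bullet> \<theta> = c \<bullet> \<theta> + a"
proof -
  have "(1 / normM A \<theta>) *\<^sub>R (A *v \<theta>) \<bullet> \<theta> = p \<bullet> p / norm p"
    using commit_inner[of \<theta>] by (simp add: p_def)
  also have "\<dots> = a" using a_pos by (simp add: a_def power2_norm_eq_inner[symmetric] power2_eq_square)
  finally show ?thesis by (simp only: x_star_def inner_add_left)
qed

lemma run_commit:
  assumes "run f = Some (K, xc)"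
  shows "0 \<le> a - xc \<bullet> \<theta>" "a - xc \<bullet> \<theta> \<le> 2 * a"
proof -
  obtain th where xc: "xc = (1 / normM A th) *\<^sub>R (A *v th)"
    using assms by (auto simp: run_def e2tc_def Let_def split: if_splits)
  have eq: "xc \<bullet> \<theta> = p \<bullet> (msqrt A *v th) / norm (msqrt A *v th)" unfolding xc by (rule commit_inner)
  show "0 \<le> a - xc \<bullet> \<theta>" unfolding eq a_def by (rule commit_regret(1)[OF p_nz])
  \<comment> \<open>The upper bound is the nonnegativity of the loss for the opposite
    direction.\<close>
  have "0 \<le> norm p - p \<bullet> (- (msqrt A *v th)) / norm (- (msqrt A *v th))"
    by (rule commit_regret(1)[OF p_nz])
  thus "a - xc \<bullet> \<theta> \<le> 2 * a" unfolding eq a_def by simp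
qed

lemma run_stops:
  assumes i: "1 \<le> i" and st: "3 * U i < Bhat f i" "\<forall>j\<in>{1..<i}. \<not> 3 * U j < Bhat f j"
    and m: "m = nat \<lceil>\<sigma> * sqrt (real T) / Bhat f i\<rceil>" "0 < m"
  obtains xc where "run f = Some (CARD('n) * (2 ^ i - 1) + CARD('n) * m, xc)"
    "a - xc \<bullet> \<theta> \<le> loss (block_avg ord (2 ^ i - 1) m f)"
proof -
  let ?P = "\<lambda>i. phase1_stop A ord (2 * \<sigma>\<^sup>2) (real T / 2) 3 (rewards f) i"
  let ?b = "2 ^ i - 1 :: nat"
  have ex: "\<exists>i\<ge>1. ?P i" using i st(1) phase1_stop_iff by blast
  have least: "(LEAST i. 1 \<le> i \<and> ?P i) = i"
  proof (rule Least_equality)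
    show "1 \<le> i \<and> ?P i" using i st(1) phase1_stop_iff by blast
    fix j assume j: "1 \<le> j \<and> ?P j"
    hence "3 * U j < Bhat f j" using phase1_stop_iff by blast
    thus "i \<le> j" using j st(2) by (meson atLeastLessThan_iff not_le)
  qed
  define th where "th = ls_est A ord (rewards f) {CARD('n) * ?b..<CARD('n) * ?b + CARD('n) * m}"
  define xc where "xc = (1 / normM A th) *\<^sub>R (A *v th)"
  have "run f = Some (CARD('n) * ?b + CARD('n) * m, xc)"
    unfolding run_def e2tc_def if_P[OF ex] Let_def least blk_end_eq[OF i] normM_phase1_est[OF i]
      sqrt_horizon m(1)[symmetric] xc_def th_def ..
  moreover have "a - xc \<bullet> \<theta> \<le> loss (block_avg ord ?b m f)"
  proof -
    have th: "msqrt A *v th = p + block_avg ord ?b m f"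
      unfolding th_def by (rule msqrt_ls_est_rewards[OF m(2)])
    have "xc \<bullet> \<theta> = p \<bullet> (msqrt A *v th) / norm (msqrt A *v th)" unfolding xc_def by (rule commit_inner)
    thus ?thesis
      using commit_regret(2)[OF p_nz, of "p + block_avg ord ?b m f"]
      unfolding th loss_def a_def by simp
  qed
  ultimately show ?thesis by (rule that)
qed

definition explore :: "nat \<Rightarrow> real^'n" where
  "explore t = (if even (t - 1) then c else c + rr_action A ord ((t - 1) div 2))"

lemma regret_explore: "(x_star A c \<theta> - explore t) \<bullet> \<theta> \<le> (if even (t - 1) then a else 2 * a)"
proof -
  have "- a \<le> rr_action A ord ((t - 1) div 2) \<bullet> \<theta>"
    unfolding rr_action_inner[OF A] p_def[symmetric] a_def
    using component_le_norm_cart[of p] by (metis abs_le_iff minus_le_iff)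
  thus ?thesis by (simp add: explore_def inner_diff_left inner_add_left x_star_inner)
qed

lemma regret_None: "run f = None \<Longrightarrow> regret f t = (x_star A c \<theta> - explore t) \<bullet> \<theta>"
  unfolding regret_def reduction_action_def run_def explore_def Let_def by (simp only: option.case)

lemma regret_Some:
  "run f = Some (K, xc) \<Longrightarrow> regret f t =
    (if (t - 1) div 2 < K then (x_star A c \<theta> - explore t) \<bullet> \<theta> else a - xc \<bullet> \<theta>)"
proof (cases "(t - 1) div 2 < K")
  case True
  assume "run f = Some (K, xc)"
  with True show ?thesis
    unfolding regret_def reduction_action_def run_def explore_def Let_def
    by (simp only: option.case prod.case if_True)
next
  case False
  assume "run f = Some (K, xc)"
  with False have "regret f t = (x_star A c \<theta> - (c + xc)) \<bullet> \<theta>"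
    unfolding regret_def reduction_action_def run_def Let_def
    by (simp only: option.case prod.case if_False)
  also have "\<dots> = a - xc \<bullet> \<theta>" by (simp add: inner_diff_left inner_add_left x_star_inner)
  finally show ?thesis using False by (simp only: if_False)
qed

lemma regret_le: "regret f t \<le> 2 * a"
proof -
  have E: "(x_star A c \<theta> - explore t) \<bullet> \<theta> \<le> 2 * a"
    using regret_explore[of t] a_pos by (simp split: if_splits)
  show ?thesis
  proof (cases "run f")
    case None
    show ?thesis using E unfolding regret_None[OF None] .
  next
    case (Some Kx)
    then obtain K xc where run: "run f = Some (K, xc)" by (cases Kx) auto
    show ?thesis using E run_commit(2)[OF run] unfolding regret_Some[OF run] by presburger
  qed
qed

text \<open>The loss of the committed action is nonnegative, so it may be charged to all T rounds,
  exploration included. What remains is supported on the first 2K rounds, at 3a per pair; a horizon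
  that ends earlier only removes nonnegative terms.\<close>

lemma regret_le_commit:
  assumes run: "run f = Some (K, xc)"
  shows "(\<Sum>t = 1..T. regret f t) \<le> 3 * a * real K + real T * (a - xc \<bullet> \<theta>)"
proof -
  define g where "g t = (if (t - 1) div 2 < K then if even (t - 1) then a else 2 * a else 0)" for t :: nat
  have g0: "0 \<le> g t" for t using a_pos by (simp add: g_def)
  have "regret f t \<le> g t + (a - xc \<bullet> \<theta>)" for t
  proof (cases "(t - 1) div 2 < K")
    case True
    hence "regret f t \<le> g t"
      unfolding regret_Some[OF run] g_def using regret_explore[of t] by (simp only: if_True)
    thus ?thesis using run_commit(1)[OF run] by simp
  next
    case False
    hence "regret f t = a - xc \<bullet> \<theta>" unfolding regret_Some[OF run] by (simp only: if_False)
    thus ?thesis using g0[of t] by simp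
  qed
  hence "(\<Sum>t = 1..T. regret f t) \<le> (\<Sum>t = 1..T. g t + (a - xc \<bullet> \<theta>))" by (intro sum_mono)
  also have "\<dots> = (\<Sum>t = 1..T. g t) + real T * (a - xc \<bullet> \<theta>)" by (simp add: sum.distrib)
  also have "(\<Sum>t = 1..T. g t) \<le> 3 * a * real K"
  proof -
    have "(\<Sum>t = 1..T. g t) = (\<Sum>t<T. g (Suc t))"
      by (simp add: lessThan_atLeast0 sum.shift_bounds_Suc_ivl[symmetric] atLeastLessThanSuc_atLeastAtMost)
    also have "\<dots> = (\<Sum>t\<in>{t. t < T \<and> t < 2 * K}. g (Suc t))"
      by (rule sum.mono_neutral_right) (auto simp: g_def)
    also have "\<dots> \<le> (\<Sum>t<2 * K. g (Suc t))"
      by (rule sum_mono2) (auto simp: g0)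
    also have "\<dots> \<le> (\<Sum>t<2 * K. if even t then a else 2 * a)"
      by (rule sum_mono) (use a_pos in \<open>auto simp: g_def\<close>)
    also have "\<dots> = 3 * a * real K" by (induction K) (simp_all add: algebra_simps)
    finally show ?thesis .
  qed
  finally show ?thesis by simp
qed

text \<open>The random stopping block and cycle number become summation indices weighted by
  indicators, so that expectations can be taken term by term over a deterministic finite set.
  \<open>U0\<close> and \<open>Ui\<close> say that \<open>i0\<close> is the first block with a > 5
  U.\<close>

lemma pathwise_regret:
  assumes i0: "1 \<le> i0" and U0: "5 * U i0 < a" and Ui: "\<And>i. 1 \<le> i \<Longrightarrow> i < i0 \<Longrightarrow> a \<le> 5 * U i"
  defines "m0 \<equiv> nat \<lceil>\<sigma> * sqrt (real T) / (3 * a / 5)\<rceil>"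
  shows "(\<Sum>t = 1..T. regret f t) \<le>
      (\<Sum>i\<in>{1..<i0}. of_bool (overestimates f i) * (2 * a * real T)) + of_bool (deviates f i0) * (2 * a * real T)
      + 6 * a * real (blk_len CARD('n) i0)
      + (\<Sum>(i, m)\<in>{1..i0} \<times> {1..m0}. of_bool (stops f i m) *
          (3 * a * real CARD('n) * real m + real T * loss (block_avg ord (2 ^ i - 1) m f)))"
    (is "?L \<le> ?O + ?F + ?P + ?S")
proof -
  have loss0: "0 \<le> loss x" for x using a_pos by (simp add: loss_def)
  have O0: "0 \<le> ?O" and F0: "0 \<le> ?F" and P0: "0 \<le> ?P" using a_pos by (auto intro!: sum_nonneg)
  have S0: "0 \<le> ?S"
  proof (rule sum_nonneg)
    fix x :: "nat \<times> nat"
    show "0 \<le> (case x of (i, m) \<Rightarrow> of_bool (stops f i m) *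
        (3 * a * real CARD('n) * real m + real T * loss (block_avg ord (2 ^ i - 1) m f)))"
      using a_pos loss0 by (cases x) (simp only: prod.case, intro mult_nonneg_nonneg add_nonneg_nonneg, simp_all)
  qed
  have all: "?L \<le> 2 * a * real T"
  proof -
    have "?L \<le> (\<Sum>t = 1..T. 2 * a)" by (intro sum_mono regret_le)
    thus ?thesis by (simp add: mult_ac)
  qed
  have bad: "l \<le> o' + f' + p' + s'"
    if "l \<le> x" "x \<le> o' \<or> x \<le> f'" "0 \<le> o'" "0 \<le> f'" "0 \<le> p'" "0 \<le> s'" for l x o' f' p' s' :: real
    using that by auto
  have good: "l \<le> o' + f' + p' + s'"
    if "l \<le> p' + s'" "0 \<le> o'" "0 \<le> f'" for l o' f' p' s' :: real
    using that by simp
  consider "deviates f i0" | i where "i \<in> {1..<i0}" "overestimates f i" |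
    "\<not> deviates f i0" "\<forall>i\<in>{1..<i0}. \<not> overestimates f i" by blast
  thus ?thesis
  proof cases
    case 1
    hence "2 * a * real T \<le> ?F" by simp
    thus ?thesis by (intro bad[OF all _ O0 F0 P0 S0] disjI2)
  next
    case (2 i)
    have "2 * a * real T = of_bool (overestimates f i) * (2 * a * real T)" using 2 by simp
    also have "\<dots> \<le> ?O" by (rule member_le_sum) (use 2 a_pos in auto)
    finally show ?thesis by (intro bad[OF all _ O0 F0 P0 S0] disjI1)
  next
    case 3
    let ?x = "block_avg ord (2 ^ (i0 - 1) - 1) (2 ^ (i0 - 1)) f :: real^'n"
    have x: "norm ?x < 2 * U i0" using 3(1) by (simp add: deviates_def)
    have lo: "a - norm ?x \<le> Bhat f i0"
      using norm_triangle_ineq4[of "p + ?x" ?x] by (simp add: Bhat_def a_def)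
    have hi: "Bhat f i0 \<le> a + norm ?x" unfolding Bhat_def a_def by (rule norm_triangle_ineq)
    have stop0: "3 * U i0 < Bhat f i0" using x lo U0 by simp
    define i where "i = (LEAST i. 1 \<le> i \<and> 3 * U i < Bhat f i)"
    have "1 \<le> i \<and> 3 * U i < Bhat f i"
      unfolding i_def by (rule LeastI[of _ i0]) (use i0 stop0 in simp)
    hence i: "1 \<le> i" "3 * U i < Bhat f i" by blast+
    have i_le: "i \<le> i0" unfolding i_def by (rule Least_le) (use i0 stop0 in simp)
    have before: "\<forall>j\<in>{1..<i}. \<not> 3 * U j < Bhat f j"
    proof
      fix j assume j: "j \<in> {1..<i}"
      hence "j < (LEAST i. 1 \<le> i \<and> 3 * U i < Bhat f i)" by (simp add: i_def)
      from not_less_Least[OF this] j show "\<not> 3 * U j < Bhat f j" by simp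
    qed
    \<comment> \<open>At \<open>i0\<close> the deviation is below 2 U(i0) < 2a/5, which gives both
      bounds. Before \<open>i0\<close>, stopping gives Bhat > 3 U(i) >= 3a/5, and as the stopping
      threshold is passed, the absence of an overestimate can only mean Bhat < 3a/2.\<close>
    have range: "3 * a / 5 \<le> Bhat f i \<and> Bhat f i \<le> 3 * a / 2"
    proof (cases "i = i0")
      case True
      thus ?thesis using x lo hi U0 by simp
    next
      case False
      hence "i \<in> {1..<i0}" using i i_le by simp
      thus ?thesis using Ui[of i] i(2) bspec[OF 3(2), of i] by (simp add: overestimates_def)
    qed
    define m where "m = nat \<lceil>\<sigma> * sqrt (real T) / Bhat f i\<rceil>"
    have B: "0 < Bhat f i" using i(2) U_pos[of i] by simp
    have m0: "0 < m" unfolding m_def using \<sigma> T B by simp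
    have "\<sigma> * sqrt (real T) / Bhat f i \<le> \<sigma> * sqrt (real T) / (3 * a / 5)"
      using range \<sigma> a_pos B by (intro divide_left_mono) auto
    hence m_le: "m \<le> m0" unfolding m_def m0_def by (intro nat_mono ceiling_mono)
    obtain xc where xc: "run f = Some (CARD('n) * (2 ^ i - 1) + CARD('n) * m, xc)"
      "a - xc \<bullet> \<theta> \<le> loss (block_avg ord (2 ^ i - 1) m f)"
      using run_stops[OF i before m_def m0] by blast
    have "?L \<le> 3 * a * real (CARD('n) * (2 ^ i - 1) + CARD('n) * m) + real T * (a - xc \<bullet> \<theta>)"
      by (rule regret_le_commit[OF xc(1)])
    also have "\<dots> \<le> 3 * a * real (CARD('n) * (2 ^ i - 1) + CARD('n) * m)
        + real T * loss (block_avg ord (2 ^ i - 1) m f)"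
      using xc(2) by (intro add_left_mono mult_left_mono) auto
    also have "\<dots> = 3 * a * real (CARD('n) * (2 ^ i - 1)) +
        (3 * a * real CARD('n) * real m + real T * loss (block_avg ord (2 ^ i - 1) m f))"
      by (simp only: of_nat_add of_nat_mult distrib_left mult.assoc add.assoc)
    finally have split: "?L \<le> 3 * a * real (CARD('n) * (2 ^ i - 1)) +
        (3 * a * real CARD('n) * real m + real T * loss (block_avg ord (2 ^ i - 1) m f))" .
    have P: "3 * a * real (CARD('n) * (2 ^ i - 1)) \<le> ?P"
    proof -
      \<comment> \<open>The blocks double, so Phase 1 takes fewer than twice the steps of its last
        block; at 3a per step this is the summand with factor 6.\<close>
      have "CARD('n) * (2 ^ i - 1) \<le> 2 * blk_len CARD('n) i0"
      proof -
        have "(2::nat) ^ i \<le> 2 * 2 ^ (i0 - 1)"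
          using i_le i0 power_increasing[of i i0 "2::nat"] by (simp add: power_Suc[symmetric] del: power_Suc)
        hence "CARD('n) * (2 ^ i - 1) \<le> CARD('n) * (2 * 2 ^ (i0 - 1))" by (intro mult_le_mono2) linarith
        thus ?thesis by (simp add: blk_len_def mult_ac)
      qed
      hence "real (CARD('n) * (2 ^ i - 1)) \<le> 2 * real (blk_len CARD('n) i0)" by linarith
      hence "3 * a * real (CARD('n) * (2 ^ i - 1)) \<le> 3 * a * (2 * real (blk_len CARD('n) i0))"
        using a_pos by (intro mult_left_mono) auto
      thus ?thesis by simp
    qed
    have S: "3 * a * real CARD('n) * real m + real T * loss (block_avg ord (2 ^ i - 1) m f) \<le> ?S"
    proof -
      have st: "stops f i m" using i before range by (simp add: stops_def m_def)
      have mem: "(i, m) \<in> {1..i0} \<times> {1..m0}" using i(1) i_le m0 m_le by simp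
      have "(case (i, m) of (i, m) \<Rightarrow> of_bool (stops f i m) *
          (3 * a * real CARD('n) * real m + real T * loss (block_avg ord (2 ^ i - 1) m f))) \<le> ?S"
      proof (rule member_le_sum[OF mem])
        fix x :: "nat \<times> nat"
        show "0 \<le> (case x of (i, m) \<Rightarrow> of_bool (stops f i m) *
            (3 * a * real CARD('n) * real m + real T * loss (block_avg ord (2 ^ i - 1) m f)))"
          using a_pos loss0 by (cases x) (simp only: prod.case, intro mult_nonneg_nonneg add_nonneg_nonneg, simp_all)
      qed simp
      thus ?thesis using st by simp
    qed
    show ?thesis by (rule good[OF order_trans[OF split add_mono[OF P S]] O0 F0])
  qed
qed

end

section \<open>Confidence radii\<close>

lemma exp_1_ge: "27 / 10 \<le> exp (1::real)"
proof -
  have "1 + 1 / 8 + (1 / 8)\<^sup>2 / 2 \<le> exp (1 / 8 :: real)" by (rule exp_lower_Taylor_quadratic) simp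
  hence "(1 + 1 / 8 + (1 / 8)\<^sup>2 / 2) ^ 8 \<le> exp (1 / 8 :: real) ^ 8" by (intro power_mono) auto
  also have "\<dots> = exp 1" by (simp add: exp_of_nat_mult[symmetric])
  finally show ?thesis by (simp add: power2_eq_square eval_nat_numeral)
qed

text \<open>The maximum 1 / (e k) is attained at x = 1 / k, and e is bounded below by 27/10. With x
  the dimension, this absorbs the extra factor d in the cost of a failure.\<close>

lemma times_exp_neg_le:
  fixes x k :: real
  assumes "0 < k"
  shows "x * exp (- k * x) \<le> 1 / (27 / 10 * k)"
proof -
  have "k * x \<le> exp (k * x - 1)" using exp_ge_add_one_self[of "k * x - 1"] by simp
  hence "k * x * exp (- k * x) \<le> exp (k * x - 1) * exp (- k * x)" by (intro mult_right_mono) auto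
  also have "\<dots> = 1 / exp 1" by (simp add: exp_diff exp_minus field_simps)
  also have "\<dots> \<le> 1 / (27 / 10)" using exp_1_ge by (intro divide_left_mono) auto
  finally have "k * (x * exp (- k * x)) \<le> 1 / (27 / 10)" by (simp only: mult.assoc)
  thus ?thesis using assms by (simp add: field_simps)
qed

text \<open>The value ln(3/2) / 2 is about 0.203. The left side is the dimensional factor of the
  tail bound at the rate used for Phase 1.\<close>

lemma sqrt_two_thirds: "1 / sqrt (2 / 3) ^ n \<le> exp (21 / 100 * real n)"
proof -
  have "(3 / 2 :: real) \<le> 1 + 42 / 100 + (42 / 100)\<^sup>2 / 2" by (simp add: power2_eq_square)
  also have "\<dots> \<le> exp (42 / 100)" by (rule exp_lower_Taylor_quadratic) simp
  also have "\<dots> = (exp (21 / 100))\<^sup>2" by (simp add: exp_of_nat_mult[symmetric])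
  finally have "sqrt (3 / 2) \<le> exp (21 / 100)" by (intro real_le_lsqrt) auto
  hence "sqrt (3 / 2) ^ n \<le> exp (21 / 100) ^ n" by (intro power_mono) auto
  moreover have "1 / sqrt (2 / 3) ^ n = sqrt (3 / 2) ^ n"
    by (simp add: real_sqrt_divide power_divide)
  ultimately show ?thesis by (simp add: exp_of_nat_mult[symmetric] mult.commute)
qed

text \<open>The value ln(3) / 2 is about 0.549. This estimate is the origin of 2d/3 in the
  exponential term of the theorem.\<close>

lemma sqrt_one_third: "1 / sqrt (1 / 3) ^ n \<le> exp (2 * real n / 3)"
proof -
  have "(3 :: real) \<le> 1 + 4 / 3 + (4 / 3)\<^sup>2 / 2" by (simp add: power2_eq_square)
  also have "\<dots> \<le> exp (4 / 3)" by (rule exp_lower_Taylor_quadratic) simp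
  also have "\<dots> = (exp (2 / 3))\<^sup>2" by (simp add: exp_of_nat_mult[symmetric])
  finally have "sqrt 3 \<le> exp (2 / 3)" by (intro real_le_lsqrt) auto
  hence "sqrt 3 ^ n \<le> exp (2 / 3) ^ n" by (intro power_mono) auto
  moreover have "1 / sqrt (1 / 3) ^ n = sqrt 3 ^ n"
    by (simp add: real_sqrt_divide power_divide)
  ultimately show ?thesis by (simp add: exp_of_nat_mult[symmetric] mult.commute)
qed

section \<open>Size of the radii, length of Phase 1, measurability of the stopping event\<close>

context ellipsoid_bandit
begin

definition log_inv_\<delta> :: "nat \<Rightarrow> real" where "log_inv_\<delta> i = ln (1 / \<delta> i)"

lemma log_inv_\<delta>_nonneg: "0 \<le> log_inv_\<delta> i"
  unfolding log_inv_\<delta>_def using \<delta>_bounds[of i] by (intro ln_ge_zero) simp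

lemma exp_neg_log_inv_\<delta>: "exp (- log_inv_\<delta> i) = \<delta> i"
  unfolding log_inv_\<delta>_def using \<delta>_bounds[of i] by (simp add: ln_div)

lemma U_sq: "(U i)\<^sup>2 = 2 * \<sigma>\<^sup>2 * (real CARD('n))\<^sup>2 / real (blk_len CARD('n) i) *
    (1 + 2 * sqrt (1 / real CARD('n) * log_inv_\<delta> i) + 2 / real CARD('n) * log_inv_\<delta> i)"
  unfolding U_def Ufun_def log_inv_\<delta>_def[symmetric] using log_inv_\<delta>_nonneg[of i]
  by (intro real_sqrt_pow2 mult_nonneg_nonneg add_nonneg_nonneg) auto

text \<open>The factor in front is the variance proxy of one noise coordinate in block i. Dropping
  the square root term of \<open>U\<close> leaves d + 2 ln(1/\<delta>) in these units, the form that
  the tail bounds consume.\<close>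

lemma U_sq_ge: "2 * \<sigma>\<^sup>2 / real (2 ^ (i - 1)) * (real CARD('n) + 2 * log_inv_\<delta> i) \<le> (U i)\<^sup>2"
proof -
  have "2 * \<sigma>\<^sup>2 / real (2 ^ (i - 1)) * (real CARD('n) + 2 * log_inv_\<delta> i) =
      2 * \<sigma>\<^sup>2 * (real CARD('n))\<^sup>2 / real (blk_len CARD('n) i) * (1 + 2 / real CARD('n) * log_inv_\<delta> i)"
    by (simp add: blk_len_def field_simps power2_eq_square)
  also have "\<dots> \<le> (U i)\<^sup>2" unfolding U_sq using log_inv_\<delta>_nonneg[of i]
    by (intro mult_left_mono) auto
  finally show ?thesis .
qed

lemma \<delta>_le: "\<delta> i * (2 * a * real T) \<le> 4 * a * real CARD('n) * real (blk_len CARD('n) i)"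
proof -
  have "\<delta> i \<le> real CARD('n) * real (blk_len CARD('n) i) / (real T / 2)" by (simp add: \<delta>_def delta_i_def)
  hence "\<delta> i * (2 * a * real T) \<le> real CARD('n) * real (blk_len CARD('n) i) / (real T / 2) * (2 * a * real T)"
    using a_pos by (intro mult_right_mono) auto
  thus ?thesis using T by simp
qed

lemma sum_blk_len: "1 \<le> i \<Longrightarrow> (\<Sum>j\<in>{1..<i}. real (blk_len CARD('n) j)) \<le> real (blk_len CARD('n) i)"
proof -
  assume i: "1 \<le> i"
  have "blk_start CARD('n) i \<le> blk_len CARD('n) i"
    unfolding blk_start_eq[OF i] blk_len_def by (intro mult_le_mono2) simp
  thus ?thesis unfolding blk_start_def by (metis of_nat_le_iff of_nat_sum)
qed

text \<open>Once a block is so long that its \<delta> is capped at 1, the logarithm vanishes and U^2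
  decays like the inverse block length.\<close>

lemma exists_detectable: "\<exists>i\<ge>1. 5 * U i < a"
proof -
  have "\<exists>k. max (real T) (50 * \<sigma>\<^sup>2 * real CARD('n) / a\<^sup>2) < 2 ^ k" by (rule real_arch_pow) simp
  then obtain k where k: "max (real T) (50 * \<sigma>\<^sup>2 * real CARD('n) / a\<^sup>2) < 2 ^ k" by blast
  define i where "i = Suc k"
  have n: "real (blk_len CARD('n) i) = real CARD('n) * 2 ^ k" by (simp add: blk_len_def i_def)
  have d1: "1 \<le> real CARD('n)" by simp
  have "real T / 2 \<le> real CARD('n) * (real CARD('n) * 2 ^ k)"
  proof -
    have "real T \<le> 2 ^ k" using k by simp
    also have "\<dots> \<le> real CARD('n) * 2 ^ k" using mult_right_mono[OF d1, of "2 ^ k"] by simp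
    also have "\<dots> \<le> real CARD('n) * (real CARD('n) * 2 ^ k)"
      using mult_right_mono[OF d1, of "real CARD('n) * 2 ^ k"] by simp
    finally show ?thesis by simp
  qed
  hence "1 \<le> real CARD('n) * real (blk_len CARD('n) i) / (real T / 2)"
    unfolding n using T by (subst pos_le_divide_eq) auto
  hence "\<delta> i = 1" by (simp only: \<delta>_def delta_i_def min_absorb2)
  hence "log_inv_\<delta> i = 0" by (simp add: log_inv_\<delta>_def)
  hence "(U i)\<^sup>2 = 2 * \<sigma>\<^sup>2 * real CARD('n) / 2 ^ k"
    unfolding U_sq n by (simp add: power2_eq_square)
  moreover have "50 * \<sigma>\<^sup>2 * real CARD('n) / 2 ^ k < a\<^sup>2"
  proof -
    have "50 * \<sigma>\<^sup>2 * real CARD('n) / a\<^sup>2 < 2 ^ k" using k by (simp only: max_less_iff_conj)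
    hence "50 * \<sigma>\<^sup>2 * real CARD('n) < 2 ^ k * a\<^sup>2" using a_pos by (subst (asm) pos_divide_less_eq) auto
    thus ?thesis by (subst pos_divide_less_eq) (auto simp: mult.commute)
  qed
  ultimately have "(5 * U i)\<^sup>2 < a\<^sup>2" by (simp add: power_mult_distrib)
  hence "5 * U i < a" by (rule power_less_imp_less_base) (use a_pos in simp)
  thus ?thesis by (intro exI[of _ i]) (simp add: i_def)
qed

definition log_factor :: real where
  "log_factor = lbar (real T * a\<^sup>2 / (4 * \<sigma>\<^sup>2 * real CARD('n) ^ 2))"

lemma log_factor_ge_1: "1 \<le> log_factor"
  by (simp add: log_factor_def lbar_def)

text \<open>Squaring the hypothesis gives a^2 n <= 50 \<sigma>^2 d^2 times the bracket in U^2, and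
  the bracket is at most 1.7072 times the logarithmic factor. The constant 2622 exceeds 29 * 50 *
  1.7072; the 29 is the total cost per step of a block, doubled because the lemma is applied to the
  block before i0.\<close>

lemma detection_length:
  assumes i: "a \<le> 5 * U i"
  shows "29 * a * real (blk_len CARD('n) i) \<le> 2622 * \<sigma>\<^sup>2 * real CARD('n) ^ 2 / a * log_factor"
proof -
  define n where "n = real (blk_len CARD('n) i)"
  define d where "d = real CARD('n)"
  define L where "L = log_inv_\<delta> i"
  have n0: "0 < n" using blk_len_pos[of i] by (simp add: n_def)
  have d2: "2 \<le> d" using card2 by (simp add: d_def)
  have L0: "0 \<le> L" using log_inv_\<delta>_nonneg by (simp add: L_def)
  define X where "X = \<sigma>\<^sup>2 * d\<^sup>2 * log_factor"
  have X0: "0 \<le> X" using log_factor_ge_1 by (simp add: X_def)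
  have scaled: ?thesis if "29 * (a\<^sup>2 * n) \<le> 2622 * X"
  proof -
    have "29 * a * n * a \<le> 2622 * X" using that by (simp add: power2_eq_square mult_ac)
    hence "29 * a * n \<le> 2622 * X / a" using a_pos by (subst pos_le_divide_eq)
    thus ?thesis by (simp add: n_def d_def X_def)
  qed
  show ?thesis
  \<comment> \<open>if \<open>n\<close> is this short the bound is immediate; otherwise \<open>1 + L \<le> log_factor\<close>\<close>
  proof (cases "a\<^sup>2 * n < 2 * \<sigma>\<^sup>2 * d")
    case True
    have "2 * \<sigma>\<^sup>2 * d \<le> 2 * \<sigma>\<^sup>2 * d\<^sup>2" using d2 by (intro mult_left_mono) (auto simp: power2_eq_square)
    hence "a\<^sup>2 * n \<le> 2 * (\<sigma>\<^sup>2 * d\<^sup>2)" using True by (simp add: mult.assoc)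
    also have "\<dots> \<le> 2 * X"
      using mult_left_mono[OF log_factor_ge_1, of "\<sigma>\<^sup>2 * d\<^sup>2"] by (simp add: X_def)
    finally show ?thesis using X0 by (intro scaled) linarith
  next
    case False
    have LL: "1 + L \<le> log_factor"
    proof -
      \<comment> \<open>If \<delta> is not capped, 1/\<delta> = T / (2 d n), and n >= 2 \<sigma>^2 d
        / a^2 in this case turns it into the argument of the logarithm in the theorem.\<close>
      have "1 / \<delta> i \<le> max (real T * a\<^sup>2 / (4 * \<sigma>\<^sup>2 * d\<^sup>2)) 1"
      proof (cases "d * n / (real T / 2) \<le> 1")
        case True
        hence "1 / \<delta> i = real T / (2 * d * n)" using T n0 d2 by (simp add: \<delta>_def delta_i_def n_def d_def min_def)
        also have "\<dots> \<le> real T * a\<^sup>2 / (4 * \<sigma>\<^sup>2 * d\<^sup>2)"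
        proof -
          have "real T * (2 * \<sigma>\<^sup>2 * d) * (2 * d) \<le> real T * (a\<^sup>2 * n) * (2 * d)"
            using False d2 by (intro mult_right_mono mult_left_mono) auto
          thus ?thesis using n0 d2 \<sigma> T by (simp add: field_simps power2_eq_square)
        qed
        finally show ?thesis by simp
      next
        case False
        thus ?thesis by (simp add: \<delta>_def delta_i_def n_def d_def min_def)
      qed
      hence "ln (1 / \<delta> i) \<le> ln (max (real T * a\<^sup>2 / (4 * \<sigma>\<^sup>2 * d\<^sup>2)) 1)"
        using \<delta>_bounds[of i] by (intro ln_mono) auto
      thus ?thesis by (simp add: L_def log_inv_\<delta>_def log_factor_def lbar_def d_def)
    qed
    \<comment> \<open>For d >= 2 the left side is at most sqrt 2 * sqrt L, and sqrt L <= (1 + L) /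
      2; the constant is half of an upper bound for sqrt 2.\<close>
    have root: "2 * sqrt (1 / d * L) \<le> 7072 / 10000 * (1 + L)"
    proof -
      have "1 / d * L \<le> 1 / 2 * L" using d2 L0 by (intro mult_right_mono) (auto simp: field_simps)
      hence "2 * sqrt (1 / d * L) \<le> 2 * sqrt (L / 2)" by simp
      also have "\<dots> = sqrt 2 * sqrt L" using L0
        by (simp add: real_sqrt_divide field_simps)
      also have "\<dots> \<le> sqrt 2 * ((1 + L) / 2)"
        using arith_geo_mean_sqrt[of 1 L] L0 by (intro mult_left_mono) auto
      also have "\<dots> \<le> 14144 / 10000 * ((1 + L) / 2)"
        using L0 by (intro mult_right_mono real_le_lsqrt) (auto simp: power2_eq_square)
      finally show ?thesis by simp
    qed
    have sum_bound: "1 + x + y \<le> 17072 / 10000 * (1 + L)"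
      if "x \<le> 7072 / 10000 * (1 + L)" "y \<le> 1 * L" for x y
      using that by simp
    have "2 / d * L \<le> 1 * L" using d2 L0 by (intro mult_right_mono) auto
    hence fac: "1 + 2 * sqrt (1 / d * L) + 2 / d * L \<le> 17072 / 10000 * (1 + L)"
      using sum_bound[OF root] by blast
    have "a\<^sup>2 \<le> (5 * U i)\<^sup>2" using i a_pos by (intro power_mono) auto
    also have "\<dots> = 50 * \<sigma>\<^sup>2 * d\<^sup>2 / n * (1 + 2 * sqrt (1 / d * L) + 2 / d * L)"
      unfolding power_mult_distrib U_sq n_def d_def L_def by simp
    also have "\<dots> \<le> 50 * \<sigma>\<^sup>2 * d\<^sup>2 / n * (17072 / 10000 * log_factor)"
      using fac LL n0 by (intro mult_left_mono) auto
    also have "\<dots> = 50 * (17072 / 10000) * X / n" by (simp add: X_def)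
    finally have "a\<^sup>2 * n \<le> 50 * (17072 / 10000) * X" using n0 by (subst (asm) pos_le_divide_eq)
    thus ?thesis using X0 by (intro scaled) linarith
  qed
qed

lemma Bhat_restrict:
  assumes "1 \<le> j" "j \<le> i"
  shows "Bhat (restrict f {0..<CARD('n) * (2 ^ i - 1)}) j = Bhat f j"
    and "(\<lambda>f. Bhat f j) \<in> borel_measurable (PiM {0..<CARD('n) * (2 ^ i - 1)} (\<lambda>_. borel))"
proof -
  have "2 ^ (j - 1) - 1 + 2 ^ (j - 1) \<le> (2::nat) ^ i - 1"
  proof -
    have "2 * 2 ^ (j - 1) = (2::nat) ^ j" using assms(1) by (simp add: power_Suc[symmetric] del: power_Suc)
    moreover have "(2::nat) ^ j \<le> 2 ^ i" using assms(2) by (intro power_increasing) auto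
    moreover have "(1::nat) \<le> 2 ^ (j - 1)" by simp
    ultimately show ?thesis by linarith
  qed
  hence N: "0 \<le> CARD('n) * (2 ^ (j - 1) - 1)"
      "CARD('n) * (2 ^ (j - 1) - 1 + 2 ^ (j - 1)) \<le> CARD('n) * (2 ^ i - 1)"
    by (simp_all only: mult_le_mono2 le0)
  show "Bhat (restrict f {0..<CARD('n) * (2 ^ i - 1)}) j = Bhat f j"
    unfolding Bhat_def by (simp only: block_avg_restrict(1)[OF ord_bij N])
  have [measurable]: "block_avg ord (2 ^ (j - 1) - 1) (2 ^ (j - 1)) \<in>
      PiM {0..<CARD('n) * (2 ^ i - 1)} (\<lambda>_. borel) \<rightarrow>\<^sub>M (borel :: (real^'n) measure)"
    by (rule block_avg_measurable[OF ord_bij N])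
  show "(\<lambda>f. Bhat f j) \<in> borel_measurable (PiM {0..<CARD('n) * (2 ^ i - 1)} (\<lambda>_. borel))"
    unfolding Bhat_def by measurable
qed

lemma stops_past:
  assumes i: "1 \<le> i"
  shows "stops (restrict f {0..<CARD('n) * (2 ^ i - 1)}) i m \<longleftrightarrow> stops f i m"
    and "Measurable.pred (PiM {0..<CARD('n) * (2 ^ i - 1)} (\<lambda>_. borel)) (\<lambda>f. stops f i m)"
proof -
  show "stops (restrict f {0..<CARD('n) * (2 ^ i - 1)}) i m \<longleftrightarrow> stops f i m"
    unfolding stops_def using Bhat_restrict(1)[of _ i f] i by simp
  let ?P = "PiM {0..<CARD('n) * (2 ^ i - 1)} (\<lambda>_. borel)"
  \<comment> \<open>Measurability on the product over the Phase 1 window is known for the blocks 1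
    to i; the default 0 extends it to all indices, as the quantified condition requires.\<close>
  define B where "B j f = (if 1 \<le> j \<and> j \<le> i then Bhat f j else 0)" for j f
  have [measurable]: "B j \<in> borel_measurable ?P" for j
  proof (cases "1 \<le> j \<and> j \<le> i")
    case True
    hence "B j = (\<lambda>f. Bhat f j)" by (auto simp: B_def fun_eq_iff)
    thus ?thesis using Bhat_restrict(2)[of j i] True by simp
  next
    case False
    hence "B j = (\<lambda>f. 0)" by (auto simp: B_def fun_eq_iff)
    thus ?thesis by simp
  qed
  have eq: "stops f i m \<longleftrightarrow> 3 * U i < B i f \<and> (\<forall>j\<in>{1..<i}. \<not> 3 * U j < B j f) \<and>
     nat \<lceil>\<sigma> * sqrt (real T) / B i f\<rceil> = m \<and> 3 * a / 5 \<le> B i f \<and> B i f \<le> 3 * a / 2" for f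
    unfolding stops_def B_def using i by simp
  show "Measurable.pred ?P (\<lambda>f. stops f i m)" unfolding eq by measurable
qed

lemma loss_measurable: "loss \<in> borel_measurable borel"
  unfolding loss_def[abs_def] by measurable

end

section \<open>Expected regret\<close>

locale noisy_ellipsoid_bandit = ellipsoid_bandit A c \<theta> \<sigma> T ord + subgaussian_noise M w "2 * \<sigma>\<^sup>2" ord
  for A :: "real^'n^'n" and c \<theta> :: "real^'n" and \<sigma> :: real and T :: nat and ord :: "nat \<Rightarrow> 'n"
    and M :: "'a measure" and w :: "nat \<Rightarrow> 'a \<Rightarrow> real"
begin

section \<open>Probabilities and costs of the two failures\<close>

lemma Bhat_noise: "Bhat (\<lambda>k. w k \<omega>) i = norm (p + noise (2 ^ (i - 1) - 1) (2 ^ (i - 1)) \<omega>)"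
  by (simp add: Bhat_def noise_def)

text \<open>Rate 1 / (6 v) for coordinate variance proxy v: it makes 1 - 2 l v equal to 2/3, so the
  mean enters with factor 3/2, and the dimensional factor is only exp(0.21 d).\<close>

lemma noise_tail_sixth:
  assumes m: "0 < m"
  shows "prob {\<omega> \<in> space M. R \<le> (norm (q + noise b m \<omega>))\<^sup>2} \<le>
    exp ((3 / 2 * (norm q)\<^sup>2 - R) / (6 * (2 * \<sigma>\<^sup>2 / m)) + 21 / 100 * real CARD('n))"
proof -
  define v' where "v' = 2 * \<sigma>\<^sup>2 / real m"
  have v': "0 < v'" using m \<sigma> by (simp add: v'_def)
  define k where "k = 1 / (6 * v')"
  have kv: "1 - 2 * k * v' = 2 / 3" and k0: "0 \<le> k" using v' by (simp_all add: k_def)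
  have "prob {\<omega> \<in> space M. R \<le> (norm (q + noise b m \<omega>))\<^sup>2} \<le>
      exp (k * (norm q)\<^sup>2 / (1 - 2 * k * v') - k * R) / sqrt (1 - 2 * k * v') ^ CARD('n)"
    unfolding v'_def by (rule noise_tail[OF m k0]) (use kv in \<open>simp add: v'_def\<close>)
  also have "\<dots> = exp ((3 / 2 * (norm q)\<^sup>2 - R) / (6 * v')) * (1 / sqrt (2 / 3) ^ CARD('n))"
    unfolding kv using v' by (simp add: k_def diff_divide_distrib)
  also have "\<dots> \<le> exp ((3 / 2 * (norm q)\<^sup>2 - R) / (6 * v')) * exp (21 / 100 * real CARD('n))"
    by (intro mult_left_mono sqrt_two_thirds) simp
  finally show ?thesis by (simp add: exp_add v'_def)
qed

text \<open>After the cancellation of a^2 the exponent is -(1/2) U^2 / v + 0.21 d. As U^2 / v >= d +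
  2 ln(1/\<delta>), half of it pays for \<delta> exactly and leaves 0.5 - 0.21 = 0.29 per
  dimension.\<close>

lemma overestimates_prob:
  defines "E i \<equiv> {\<omega> \<in> space M. overestimates (\<lambda>k. w k \<omega>) i}"
  shows "E i \<in> sets M" and "prob (E i) \<le> \<delta> i * exp (- (29 / 100) * real CARD('n))"
proof -
  let ?m = "2 ^ (i - 1) :: nat" and ?b = "2 ^ (i - 1) - 1 :: nat"
  show "E i \<in> sets M" unfolding E_def overestimates_def Bhat_noise by measurable
  let ?v = "2 * \<sigma>\<^sup>2 / real ?m"
  have v: "0 < ?v" using \<sigma> by simp
  let ?R = "3 * (U i)\<^sup>2 + 3 / 2 * a\<^sup>2"
  have "E i \<subseteq> {\<omega> \<in> space M. ?R \<le> (norm (p + noise ?b ?m \<omega>))\<^sup>2}"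
  proof
    fix \<omega> assume w: "\<omega> \<in> E i"
    let ?B = "norm (p + noise ?b ?m \<omega>)"
    have "3 * U i \<le> ?B" "3 * a / 2 \<le> ?B" using w by (simp_all add: E_def overestimates_def Bhat_noise)
    hence "(3 * U i)\<^sup>2 \<le> ?B\<^sup>2" "(3 * a / 2)\<^sup>2 \<le> ?B\<^sup>2"
      using U_pos[of i] a_pos by (simp_all only: power_mono mult_nonneg_nonneg divide_nonneg_nonneg
        less_imp_le zero_le_numeral)
    \<comment> \<open>the combination \<open>1/3, 2/3\<close> makes the \<open>a\<^sup>2\<close> term cancel the noncentrality in the tail bound\<close>
    hence "9 * (U i)\<^sup>2 \<le> ?B\<^sup>2" "9 / 4 * a\<^sup>2 \<le> ?B\<^sup>2" by (simp_all add: power_mult_distrib power_divide)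
    thus "\<omega> \<in> {\<omega> \<in> space M. ?R \<le> (norm (p + noise ?b ?m \<omega>))\<^sup>2}" using w by (simp add: E_def)
  qed
  hence "prob (E i) \<le> prob {\<omega> \<in> space M. ?R \<le> (norm (p + noise ?b ?m \<omega>))\<^sup>2}"
    by (intro finite_measure_mono) measurable
  also have "\<dots> \<le> exp ((3 / 2 * (norm p)\<^sup>2 - ?R) / (6 * ?v) + 21 / 100 * real CARD('n))"
    by (rule noise_tail_sixth) simp
  also have "\<dots> \<le> exp (- log_inv_\<delta> i - (29 / 100) * real CARD('n))"
  proof -
    define Y where "Y = (U i)\<^sup>2 / ?v"
    have "?v * (real CARD('n) + 2 * log_inv_\<delta> i) \<le> (U i)\<^sup>2" by (rule U_sq_ge)
    hence "real CARD('n) + 2 * log_inv_\<delta> i \<le> Y" unfolding Y_def by (simp only: pos_le_divide_eq[OF v] mult.commute)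
    moreover have "(3 / 2 * (norm p)\<^sup>2 - ?R) / (6 * ?v) = - (1 / 2) * Y"
      using v by (simp add: Y_def a_def field_simps)
    ultimately show ?thesis by (simp only: exp_le_cancel_iff)
  qed
  also have "\<dots> = \<delta> i * exp (- (29 / 100) * real CARD('n))"
    by (simp only: diff_conv_add_uminus exp_add exp_neg_log_inv_\<delta> mult_minus_left)
  finally show "prob (E i) \<le> \<delta> i * exp (- (29 / 100) * real CARD('n))" .
qed

text \<open>Here the noise is centered and the threshold 4 U^2 gives the exponent -(2/3) U^2 / v,
  which covers \<delta> and leaves 2/3 - 0.21 > 0.45 per dimension.\<close>

lemma deviates_prob:
  defines "E i \<equiv> {\<omega> \<in> space M. deviates (\<lambda>k. w k \<omega>) i}"
  shows "E i \<in> sets M" and "prob (E i) \<le> \<delta> i * exp (- (45 / 100) * real CARD('n))"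
proof -
  let ?m = "2 ^ (i - 1) :: nat" and ?b = "2 ^ (i - 1) - 1 :: nat"
  have E_eq: "E i = {\<omega> \<in> space M. 2 * U i \<le> norm (noise ?b ?m \<omega>)}"
    by (simp add: E_def deviates_def noise_def)
  show "E i \<in> sets M" unfolding E_eq by measurable
  let ?v = "2 * \<sigma>\<^sup>2 / real ?m"
  have v: "0 < ?v" using \<sigma> by simp
  let ?R = "4 * (U i)\<^sup>2"
  have "E i \<subseteq> {\<omega> \<in> space M. ?R \<le> (norm (0 + noise ?b ?m \<omega>))\<^sup>2}"
  proof
    fix \<omega> assume w: "\<omega> \<in> E i"
    hence "2 * U i \<le> norm (noise ?b ?m \<omega>)" by (simp add: E_eq)
    hence "(2 * U i)\<^sup>2 \<le> (norm (noise ?b ?m \<omega>))\<^sup>2"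
      using U_pos[of i] by (simp only: power_mono mult_nonneg_nonneg less_imp_le zero_le_numeral)
    thus "\<omega> \<in> {\<omega> \<in> space M. ?R \<le> (norm (0 + noise ?b ?m \<omega>))\<^sup>2}" using w by (simp add: E_def power_mult_distrib)
  qed
  hence "prob (E i) \<le> prob {\<omega> \<in> space M. ?R \<le> (norm (0 + noise ?b ?m \<omega>))\<^sup>2}"
    by (intro finite_measure_mono) measurable
  also have "\<dots> \<le> exp ((3 / 2 * (norm (0::real^'n))\<^sup>2 - ?R) / (6 * ?v) + 21 / 100 * real CARD('n))"
    by (rule noise_tail_sixth) simp
  also have "\<dots> \<le> exp (- log_inv_\<delta> i - (45 / 100) * real CARD('n))"
  proof -
    define Y where "Y = (U i)\<^sup>2 / ?v"
    have "?v * (real CARD('n) + 2 * log_inv_\<delta> i) \<le> (U i)\<^sup>2" by (rule U_sq_ge)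
    hence "real CARD('n) + 2 * log_inv_\<delta> i \<le> Y" unfolding Y_def by (simp only: pos_le_divide_eq[OF v] mult.commute)
    moreover have "(3 / 2 * (norm (0::real^'n))\<^sup>2 - ?R) / (6 * ?v) = - (2 / 3) * Y"
      using v by (simp add: Y_def field_simps)
    ultimately show ?thesis using log_inv_\<delta>_nonneg[of i] by (simp only: exp_le_cancel_iff)
  qed
  also have "\<dots> = \<delta> i * exp (- (45 / 100) * real CARD('n))"
    by (simp only: diff_conv_add_uminus exp_add exp_neg_log_inv_\<delta> mult_minus_left)
  finally show "prob (E i) \<le> \<delta> i * exp (- (45 / 100) * real CARD('n))" .
qed

lemma bad_event_cost:
  assumes "x \<le> \<delta> i * exp (- k * real CARD('n))" and k: "0 < k"
  shows "x * (2 * a * real T) \<le> 4 / (27 / 10 * k) * a * real (blk_len CARD('n) i)"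
proof -
  have "x * (2 * a * real T) \<le> \<delta> i * (2 * a * real T) * exp (- k * real CARD('n))"
    using mult_right_mono[OF assms(1), of "2 * a * real T"] a_pos by (simp add: mult_ac)
  also have "\<dots> \<le> 4 * a * real CARD('n) * real (blk_len CARD('n) i) * exp (- k * real CARD('n))"
    by (intro mult_right_mono \<delta>_le) simp
  also have "\<dots> = 4 * a * real (blk_len CARD('n) i) * (real CARD('n) * exp (- k * real CARD('n)))"
    by simp
  also have "\<dots> \<le> 4 * a * real (blk_len CARD('n) i) * (1 / (27 / 10 * k))"
    using a_pos by (intro mult_left_mono times_exp_neg_le k) simp
  finally show ?thesis by (simp add: field_simps)
qed

section \<open>Cost of Phases 2 and 3\<close>

definition opposite :: real where
  "opposite = exp (negpart (2 * real CARD('n) / 3 - (1 / 9) * sqrt (real T) * a / \<sigma>))"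

text \<open>The rate 1 / (3 v) makes 1 - 2 k v equal to 1/3. With v = 2 \<sigma>^2 / m the exponent
  is a^2 m / (6 \<sigma>^2), and the lower bound on m, which stems from Bhat <= 3a/2, turns it into
  (1/6)(2/3) = 1/9 times sqrt T a / \<sigma>.\<close>

lemma opposite_prob:
  assumes m: "0 < m" and ge: "\<sigma> * sqrt (real T) / (3 * a / 2) \<le> real m"
  shows "prob {\<omega> \<in> space M. a \<le> norm (noise b m \<omega>)} \<le> opposite"
proof -
  define v' where "v' = 2 * \<sigma>\<^sup>2 / real m"
  have v': "0 < v'" using m \<sigma> by (simp add: v'_def)
  define k where "k = 1 / (3 * v')"
  have kv: "1 - 2 * k * v' = 1 / 3" and k0: "0 \<le> k" using v' by (simp_all add: k_def)
  let ?E = "{\<omega> \<in> space M. a \<le> norm (noise b m \<omega>)}"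
  have "?E \<subseteq> {\<omega> \<in> space M. a\<^sup>2 \<le> (norm (0 + noise b m \<omega>))\<^sup>2}"
    using a_pos by (auto intro!: power_mono)
  hence "prob ?E \<le> prob {\<omega> \<in> space M. a\<^sup>2 \<le> (norm (0 + noise b m \<omega>))\<^sup>2}"
    by (intro finite_measure_mono) measurable
  also have "\<dots> \<le> exp (k * (norm (0::real^'n))\<^sup>2 / (1 - 2 * k * v') - k * a\<^sup>2) / sqrt (1 - 2 * k * v') ^ CARD('n)"
    unfolding v'_def by (rule noise_tail[OF m k0]) (use kv in \<open>simp add: v'_def\<close>)
  also have "\<dots> = exp (- k * a\<^sup>2) * (1 / sqrt (1 / 3) ^ CARD('n))" unfolding kv by simp
  also have "\<dots> \<le> exp (- k * a\<^sup>2) * exp (2 * real CARD('n) / 3)"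
    by (intro mult_left_mono sqrt_one_third) simp
  also have "\<dots> \<le> exp (2 * real CARD('n) / 3 - (1 / 9) * sqrt (real T) * a / \<sigma>)"
  proof -
    have "(1 / 9) * sqrt (real T) * a / \<sigma> = a\<^sup>2 / (6 * \<sigma>\<^sup>2) * (\<sigma> * sqrt (real T) / (3 * a / 2))"
      using a_pos \<sigma> by (simp add: field_simps power2_eq_square)
    also have "\<dots> \<le> a\<^sup>2 / (6 * \<sigma>\<^sup>2) * real m" using ge by (intro mult_left_mono) auto
    also have "\<dots> = k * a\<^sup>2" using m \<sigma> by (simp add: k_def v'_def field_simps)
    finally show ?thesis by (simp add: exp_add[symmetric])
  qed
  finally have "prob ?E \<le> exp (2 * real CARD('n) / 3 - (1 / 9) * sqrt (real T) * a / \<sigma>)" .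
  \<comment> \<open>The trivial bound is what the negative part in the exponent encodes.\<close>
  moreover have "prob ?E \<le> 1" by simp
  ultimately show ?thesis unfolding opposite_def negpart_def min_def by simp
qed

lemma expected_loss:
  assumes m: "0 < m"
  shows "integrable M (\<lambda>\<omega>. loss (noise b m \<omega>))"
    and "(\<integral>\<omega>. loss (noise b m \<omega>) \<partial>M) \<le>
      real CARD('n) * (2 * \<sigma>\<^sup>2) / (real m * a) + 2 * a * prob {\<omega> \<in> space M. a \<le> norm (noise b m \<omega>)}"
proof -
  let ?E = "{\<omega> \<in> space M. a \<le> norm (noise b m \<omega>)}"
  have E: "?E \<in> sets M" by measurable
  have eq: "loss (noise b m \<omega>) = (norm (noise b m \<omega>))\<^sup>2 / a + 2 * a * indicator ?E \<omega>" if "\<omega> \<in> space M" for \<omega>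
    using that by (simp add: loss_def)
  have int: "integrable M (\<lambda>\<omega>. (norm (noise b m \<omega>))\<^sup>2 / a + 2 * a * indicator ?E \<omega>)"
    using noise_second_moment(1)[OF m, of b] E
    by (intro Bochner_Integration.integrable_add integrable_divide integrable_mult_right)
       (simp_all add: emeasure_eq_measure)
  show "integrable M (\<lambda>\<omega>. loss (noise b m \<omega>))"
    by (rule Bochner_Integration.integrable_cong[THEN iffD2, OF refl eq int])
  have "(\<integral>\<omega>. loss (noise b m \<omega>) \<partial>M) = (\<integral>\<omega>. (norm (noise b m \<omega>))\<^sup>2 / a + 2 * a * indicator ?E \<omega> \<partial>M)"
    by (rule Bochner_Integration.integral_cong[OF refl eq])
  also have "\<dots> = (\<integral>\<omega>. (norm (noise b m \<omega>))\<^sup>2 \<partial>M) / a + 2 * a * prob ?E"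
    using noise_second_moment(1)[OF m, of b] E
    by (subst Bochner_Integration.integral_add) (simp_all add: emeasure_eq_measure)
  also have "(\<integral>\<omega>. (norm (noise b m \<omega>))\<^sup>2 \<partial>M) / a \<le> (CARD('n) * (2 * \<sigma>\<^sup>2) / real m) / a"
    using noise_second_moment(2)[OF m, of b] a_pos by (intro divide_right_mono) auto
  finally show "(\<integral>\<omega>. loss (noise b m \<omega>) \<partial>M) \<le>
      real CARD('n) * (2 * \<sigma>\<^sup>2) / (real m * a) + 2 * a * prob ?E" by simp
qed

definition phase23 :: real where
  "phase23 = 7 * real CARD('n) * \<sigma> * sqrt (real T) + 3 * a * real CARD('n) + 2 * real T * a * opposite"

text \<open>\<open>B\<close> is a plain number: for fixed \<open>m\<close> the law of the Phase 2
  noise does not involve the estimate, and \<open>B\<close> only certifies the size of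
  \<open>m\<close>. The ceiling is used from below for accuracy and from above for length; the
  latter costs the summand 3 a d of \<open>phase23\<close>.\<close>

lemma phase23_cost:
  assumes B: "3 * a / 5 \<le> B" "B \<le> 3 * a / 2" and m: "nat \<lceil>\<sigma> * sqrt (real T) / B\<rceil> = m"
  shows "3 * a * real CARD('n) * real m + real T * (\<integral>\<omega>. loss (noise b m \<omega>) \<partial>M) \<le> phase23"
proof -
  let ?s = "\<sigma> * sqrt (real T)" and ?d = "real CARD('n)"
  have B0: "0 < B" using B a_pos by linarith
  have s0: "0 < ?s" using \<sigma> T by simp
  hence q0: "0 < ?s / B" using B0 by simp
  have m_ge: "?s / B \<le> real m" and m_le: "real m \<le> ?s / B + 1" using q0 m by linarith+
  have m0: "0 < m" using m_ge q0 by linarith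
  have "?s / (3 * a / 2) \<le> ?s / B" using B B0 a_pos s0 by (intro divide_left_mono) auto
  hence opp: "prob {\<omega> \<in> space M. a \<le> norm (noise b m \<omega>)} \<le> opposite"
    using m_ge m0 by (intro opposite_prob) auto
  have "(\<integral>\<omega>. loss (noise b m \<omega>) \<partial>M) \<le> ?d * (2 * \<sigma>\<^sup>2) / (real m * a) + 2 * a * opposite"
    using expected_loss(2)[OF m0, of b] mult_left_mono[OF opp, of "2 * a"] a_pos by linarith
  also have "?d * (2 * \<sigma>\<^sup>2) / (real m * a) \<le> ?d * (2 * \<sigma>\<^sup>2) / (?s / B * a)"
    using m_ge q0 a_pos m0 by (intro divide_left_mono mult_right_mono mult_pos_pos) auto
  finally have "real T * (\<integral>\<omega>. loss (noise b m \<omega>) \<partial>M) \<le>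
      real T * (?d * (2 * \<sigma>\<^sup>2) / (?s / B * a) + 2 * a * opposite)"
    by (intro mult_left_mono) auto
  also have "\<dots> = ?d * ?s * (2 * (B / a)) + 2 * real T * a * opposite"
  proof -
    have "real T = sqrt (real T) * sqrt (real T)" by simp
    hence "real T * (?d * (2 * \<sigma>\<^sup>2) / (?s / B * a)) = ?d * ?s * (2 * (B / a))"
      using \<sigma> T B0 a_pos by (simp add: field_simps power2_eq_square)
    thus ?thesis by (simp add: algebra_simps)
  qed
  finally have comm: "real T * (\<integral>\<omega>. loss (noise b m \<omega>) \<partial>M) \<le>
      ?d * ?s * (2 * (B / a)) + 2 * real T * a * opposite" .
  have "3 * a * ?d * real m \<le> 3 * a * ?d * (?s / B + 1)"
    using m_le a_pos by (intro mult_left_mono) auto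
  also have "\<dots> = ?d * ?s * (3 * (a / B)) + 3 * a * ?d" by (simp add: algebra_simps)
  finally have expl: "3 * a * ?d * real m \<le> ?d * ?s * (3 * (a / B)) + 3 * a * ?d" .
  \<comment> \<open>In \<beta> = B / a this is (2\<beta> - 1)(\<beta> - 3) <= 0, true on [1/2, 3],
    which contains [3/5, 3/2].\<close>
  have "3 * (a / B) + 2 * (B / a) \<le> 7"
  proof -
    have "(2 * B - a) * (B - 3 * a) \<le> 0"
      using B a_pos by (intro mult_nonneg_nonpos) auto
    hence "3 * a * a + 2 * B * B \<le> 7 * a * B" by (simp add: algebra_simps)
    thus ?thesis using B0 a_pos by (simp add: field_simps)
  qed
  hence "?d * ?s * (3 * (a / B) + 2 * (B / a)) \<le> ?d * ?s * 7"
    using s0 by (intro mult_left_mono) auto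
  thus ?thesis using comm expl unfolding phase23_def by (simp add: algebra_simps)
qed

lemma phase23_nonneg: "0 \<le> phase23"
  using \<sigma> a_pos by (simp add: phase23_def opposite_def)

lemma stops_term:
  fixes i m :: nat
  assumes i: "1 \<le> i"
  defines "D \<equiv> {\<omega> \<in> space M. stops (\<lambda>k. w k \<omega>) i m}"
    and "X \<equiv> \<lambda>\<omega>. of_bool (stops (\<lambda>k. w k \<omega>) i m) *
          (3 * a * real CARD('n) * real m + real T * loss (block_avg ord (2 ^ i - 1) m (\<lambda>k. w k \<omega>)))"
  assumes m: "1 \<le> m"
  shows "D \<in> sets M" and "integrable M X" and "(\<integral>\<omega>. X \<omega> \<partial>M) \<le> prob D * phase23"
proof -
  let ?\<phi> = "\<lambda>x. 3 * a * real CARD('n) * real m + real T * loss x"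
  let ?N = "noise (2 ^ i - 1) m"
  have m0: "0 < m" using m by simp
  have phi: "?\<phi> \<in> borel_measurable borel" using loss_measurable by simp
  have int: "integrable M (\<lambda>\<omega>. ?\<phi> (?N \<omega>))"
    using expected_loss(1)[OF m0] by simp
  note ind = noise_indep_of_past[OF stops_past(2)[OF i, of m] stops_past(1)[OF i, of _ m] phi int, folded D_def]
  have X: "X \<omega> = indicator D \<omega> * ?\<phi> (?N \<omega>)" if "\<omega> \<in> space M" for \<omega>
    using that by (simp add: X_def D_def noise_def)
  show "D \<in> sets M" by (rule ind(1))
  show "integrable M X"
    by (rule Bochner_Integration.integrable_cong[THEN iffD2, OF refl X ind(2)])
  have "(\<integral>\<omega>. X \<omega> \<partial>M) = prob D * (\<integral>\<omega>. ?\<phi> (?N \<omega>) \<partial>M)"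
    unfolding ind(3)[symmetric] by (rule Bochner_Integration.integral_cong[OF refl X])
  also have "\<dots> = prob D * (3 * a * real CARD('n) * real m + real T * (\<integral>\<omega>. loss (?N \<omega>) \<partial>M))"
    using expected_loss(1)[OF m0, of "2 ^ i - 1"] by (simp add: prob_space)
  also have "\<dots> \<le> prob D * phase23"
  \<comment> \<open>Any sample point of \<open>D\<close> supplies an estimate in the right range
    with exactly \<open>m\<close> cycles, so the deterministic bound applies; an empty
    \<open>D\<close> contributes nothing.\<close>
  proof (cases "D = {}")
    case False
    then obtain \<omega> where "stops (\<lambda>k. w k \<omega>) i m" by (auto simp: D_def)
    hence "3 * a / 5 \<le> Bhat (\<lambda>k. w k \<omega>) i" "Bhat (\<lambda>k. w k \<omega>) i \<le> 3 * a / 2"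
      "nat \<lceil>\<sigma> * sqrt (real T) / Bhat (\<lambda>k. w k \<omega>) i\<rceil> = m" by (simp_all add: stops_def)
    from phase23_cost[OF this] show ?thesis by (intro mult_left_mono) auto
  qed simp
  finally show "(\<integral>\<omega>. X \<omega> \<partial>M) \<le> prob D * phase23" .
qed

lemma stops_unique:
  assumes "stops f i m" "stops f j k" "1 \<le> i" "1 \<le> j"
  shows "i = j" "m = k"
proof -
  show "i = j" using assms unfolding stops_def by (metis atLeastLessThan_iff linorder_neqE_nat)
  thus "m = k" using assms unfolding stops_def by simp
qed

lemma expected_regret:
  "(\<integral>\<omega>. (\<Sum>t = 1..T. regret (\<lambda>k. w k \<omega>) t) \<partial>M) \<le>
    2622 * \<sigma>\<^sup>2 * real CARD('n) ^ 2 / a * log_factor + phase23 + 29 / 2 * a * real CARD('n)"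
proof -
  \<comment> \<open>The index is determined by a, T, \<sigma> and the dimension, not by the noise,
    so it is fixed before integrating.\<close>
  define i0 where "i0 = (LEAST i. 1 \<le> i \<and> 5 * U i < a)"
  have "1 \<le> i0 \<and> 5 * U i0 < a" unfolding i0_def using exists_detectable by (rule LeastI_ex[OF _ ])
  hence i0: "1 \<le> i0" and U0: "5 * U i0 < a" by blast+
  have before: "a \<le> 5 * U i" if "1 \<le> i" "i < i0" for i
    using not_less_Least[of i "\<lambda>i. 1 \<le> i \<and> 5 * U i < a"] that by (simp add: i0_def not_less)
  define m0 where "m0 = nat \<lceil>\<sigma> * sqrt (real T) / (3 * a / 5)\<rceil>"
  define N where "N = real (blk_len CARD('n) i0)"
  define I where "I = {1..i0} \<times> {1..m0}"
  define W where "W \<omega> = (\<lambda>k. w k \<omega>)" for \<omega>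
  define O' where "O' i \<omega> = of_bool (overestimates (W \<omega>) i) * (2 * a * real T)" for i \<omega>
  define F' where "F' \<omega> = of_bool (deviates (W \<omega>) i0) * (2 * a * real T)" for \<omega>
  define S' where "S' x \<omega> = (case x of (i, m) \<Rightarrow> of_bool (stops (W \<omega>) i m) *
      (3 * a * real CARD('n) * real m + real T * loss (block_avg ord (2 ^ i - 1) m (W \<omega>))))" for x \<omega>
  define D where "D x = {\<omega> \<in> space M. case x of (i, m) \<Rightarrow> stops (W \<omega>) i m}" for x
  have c0: "0 \<le> 2 * a * real T" using a_pos by simp
  have O: "integrable M (O' i)" "(\<integral>\<omega>. O' i \<omega> \<partial>M) \<le> 4 / (27 / 10 * (29 / 100)) * a * real (blk_len CARD('n) i)" for i
  proof -
    let ?E = "{\<omega> \<in> space M. overestimates (\<lambda>k. w k \<omega>) i}"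
    have eq: "O' i \<omega> = indicator ?E \<omega> * (2 * a * real T)" if "\<omega> \<in> space M" for \<omega>
      using that by (simp add: O'_def W_def)
    have int: "integrable M (\<lambda>\<omega>. indicator ?E \<omega> * (2 * a * real T))"
      using overestimates_prob(1)[of i] by (simp add: emeasure_eq_measure)
    show "integrable M (O' i)"
      by (rule Bochner_Integration.integrable_cong[THEN iffD2, OF refl eq int])
    have "(\<integral>\<omega>. O' i \<omega> \<partial>M) = (\<integral>\<omega>. indicator ?E \<omega> * (2 * a * real T) \<partial>M)"
      by (rule Bochner_Integration.integral_cong[OF refl eq])
    also have "\<dots> = prob ?E * (2 * a * real T)"
      using overestimates_prob(1)[of i] by simp
    also have "\<dots> \<le> 4 / (27 / 10 * (29 / 100)) * a * real (blk_len CARD('n) i)"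
      by (rule bad_event_cost[OF overestimates_prob(2)]) simp
    finally show "(\<integral>\<omega>. O' i \<omega> \<partial>M) \<le> 4 / (27 / 10 * (29 / 100)) * a * real (blk_len CARD('n) i)" .
  qed
  have F: "integrable M F'" "(\<integral>\<omega>. F' \<omega> \<partial>M) \<le> 4 / (27 / 10 * (45 / 100)) * a * N"
  proof -
    let ?E = "{\<omega> \<in> space M. deviates (\<lambda>k. w k \<omega>) i0}"
    have eq: "F' \<omega> = indicator ?E \<omega> * (2 * a * real T)" if "\<omega> \<in> space M" for \<omega>
      using that by (simp add: F'_def W_def)
    have int: "integrable M (\<lambda>\<omega>. indicator ?E \<omega> * (2 * a * real T))"
      using deviates_prob(1)[of i0] by (simp add: emeasure_eq_measure)
    show "integrable M F'"
      by (rule Bochner_Integration.integrable_cong[THEN iffD2, OF refl eq int])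
    have "(\<integral>\<omega>. F' \<omega> \<partial>M) = (\<integral>\<omega>. indicator ?E \<omega> * (2 * a * real T) \<partial>M)"
      by (rule Bochner_Integration.integral_cong[OF refl eq])
    also have "\<dots> = prob ?E * (2 * a * real T)"
      using deviates_prob(1)[of i0] by simp
    also have "\<dots> \<le> 4 / (27 / 10 * (45 / 100)) * a * N"
      unfolding N_def by (rule bad_event_cost[OF deviates_prob(2)]) simp
    finally show "(\<integral>\<omega>. F' \<omega> \<partial>M) \<le> 4 / (27 / 10 * (45 / 100)) * a * N" .
  qed
  have S: "D x \<in> sets M" "integrable M (S' x)" "(\<integral>\<omega>. S' x \<omega> \<partial>M) \<le> prob (D x) * phase23" if "x \<in> I" for x
  proof -
    obtain i m where x: "x = (i, m)" "1 \<le> i" "1 \<le> m" using \<open>x \<in> I\<close> by (auto simp: I_def)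
    note st = stops_term[OF x(2,3)]
    show "D x \<in> sets M" using st(1) by (simp add: D_def x W_def)
    show "integrable M (S' x)" unfolding S'_def[abs_def] x W_def prod.case by (rule st(2))
    show "(\<integral>\<omega>. S' x \<omega> \<partial>M) \<le> prob (D x) * phase23"
      unfolding S'_def x W_def D_def prod.case by (rule st(3))
  qed
  \<comment> \<open>A path stops at most once and thereby fixes its cycle number, so the events are
    disjoint and \<open>phase23\<close> is paid at most once in total.\<close>
  have Dsum: "(\<Sum>x\<in>I. prob (D x)) \<le> 1"
  proof -
    have "disjoint_family_on D I"
      unfolding disjoint_family_on_def I_def D_def using stops_unique by fastforce
    hence "(\<Sum>x\<in>I. prob (D x)) = prob (\<Union>x\<in>I. D x)"
      by (intro finite_measure_finite_Union[symmetric]) (use S(1) in \<open>auto simp: I_def\<close>)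
    thus ?thesis by simp
  qed
  let ?G = "\<lambda>\<omega>. (\<Sum>i\<in>{1..<i0}. O' i \<omega>) + F' \<omega> + 6 * a * N + (\<Sum>x\<in>I. S' x \<omega>)"
  have intG: "integrable M ?G"
    by (intro Bochner_Integration.integrable_add Bochner_Integration.integrable_sum O F S) auto
  have S0: "0 \<le> S' x \<omega>" for x \<omega>
    unfolding S'_def using a_pos
    by (cases x) (simp only: prod.case, intro mult_nonneg_nonneg add_nonneg_nonneg, simp_all add: loss_def)
  have G0: "0 \<le> ?G \<omega>" for \<omega>
    by (intro add_nonneg_nonneg sum_nonneg S0) (use a_pos in \<open>simp_all add: O'_def F'_def N_def\<close>)
  \<comment> \<open>\<open>integral_mono'\<close> asks only the majorant to be integrable, so the regret need not be shown measurable\<close>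
  have "(\<integral>\<omega>. (\<Sum>t = 1..T. regret (W \<omega>) t) \<partial>M) \<le> (\<integral>\<omega>. ?G \<omega> \<partial>M)"
  proof (rule integral_mono'[OF intG _ G0])
    fix \<omega>
    show "(\<Sum>t = 1..T. regret (W \<omega>) t) \<le> ?G \<omega>"
      unfolding O'_def F'_def S'_def N_def I_def m0_def by (rule pathwise_regret[OF i0 U0 before])
  qed
  also have "\<dots> = (\<Sum>i\<in>{1..<i0}. \<integral>\<omega>. O' i \<omega> \<partial>M) + (\<integral>\<omega>. F' \<omega> \<partial>M) + 6 * a * N + (\<Sum>x\<in>I. \<integral>\<omega>. S' x \<omega> \<partial>M)"
  proof -
    have 1: "integrable M (\<lambda>\<omega>. \<Sum>i\<in>{1..<i0}. O' i \<omega>)" "integrable M (\<lambda>\<omega>. \<Sum>x\<in>I. S' x \<omega>)"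
      by (intro Bochner_Integration.integrable_sum O S; assumption?)+
    show ?thesis
      using 1 F(1) by (simp add: Bochner_Integration.integral_add Bochner_Integration.integral_sum[OF O(1)]
        Bochner_Integration.integral_sum[OF S(2)] prob_space)
  qed
  \<comment> \<open>The first two constants round up 4 / (2.7 * 0.29) and 4 / (2.7 * 0.45), the
    prices of the two failures; all overestimates together cost one block because the earlier
    lengths sum to at most that of block \<open>i0\<close>. The three constants add up to less than
    29/2.\<close>
  also have "\<dots> \<le> 512 / 100 * a * N + 33 / 10 * a * N + 6 * a * N + phase23"
  proof (intro add_mono order_refl)
    have "(\<Sum>i\<in>{1..<i0}. \<integral>\<omega>. O' i \<omega> \<partial>M) \<le>
        (\<Sum>i\<in>{1..<i0}. 4 / (27 / 10 * (29 / 100)) * a * real (blk_len CARD('n) i))"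
      by (intro sum_mono O)
    also have "\<dots> = 4 / (27 / 10 * (29 / 100)) * a * (\<Sum>i\<in>{1..<i0}. real (blk_len CARD('n) i))"
      by (simp only: sum_distrib_left)
    also have "\<dots> \<le> 4 / (27 / 10 * (29 / 100)) * a * N"
      unfolding N_def using a_pos by (intro mult_left_mono sum_blk_len i0) auto
    also have "\<dots> \<le> 512 / 100 * a * N"
      using a_pos by (intro mult_right_mono) (auto simp: N_def)
    finally show "(\<Sum>i\<in>{1..<i0}. \<integral>\<omega>. O' i \<omega> \<partial>M) \<le> 512 / 100 * a * N" .
    have "4 / (27 / 10 * (45 / 100)) * a * N \<le> 33 / 10 * a * N"
      using a_pos by (intro mult_right_mono) (auto simp: N_def)
    with F(2) show "(\<integral>\<omega>. F' \<omega> \<partial>M) \<le> 33 / 10 * a * N" by linarith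
    have "(\<Sum>x\<in>I. \<integral>\<omega>. S' x \<omega> \<partial>M) \<le> (\<Sum>x\<in>I. prob (D x)) * phase23"
      unfolding sum_distrib_right by (intro sum_mono S)
    also have "\<dots> \<le> 1 * phase23" by (intro mult_right_mono Dsum phase23_nonneg)
    finally show "(\<Sum>x\<in>I. \<integral>\<omega>. S' x \<omega> \<partial>M) \<le> phase23" by simp
  qed
  also have "\<dots> \<le> 29 / 2 * a * N + phase23"
  proof -
    have "0 \<le> N * a" using a_pos by (simp add: N_def)
    thus ?thesis by simp
  qed
  \<comment> \<open>If i0 > 1, the preceding block has half the length and satisfies a <= 5 U, so
    \<open>detection_length\<close> applies. If i0 = 1, there is no such block, but N is just the
    dimension.\<close>
  also have "29 / 2 * a * N \<le> 2622 * \<sigma>\<^sup>2 * real CARD('n) ^ 2 / a * log_factor + 29 / 2 * a * real CARD('n)"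
  proof (cases "i0 = 1")
    case True
    have "0 \<le> 2622 * \<sigma>\<^sup>2 * real CARD('n) ^ 2 / a * log_factor"
      using a_pos log_factor_ge_1 by simp
    thus ?thesis using True by (simp add: N_def blk_len_def)
  next
    case False
    hence i: "1 \<le> i0 - 1" "i0 - 1 < i0" using i0 by auto
    have "i0 - 1 = Suc (i0 - 1 - 1)" using i by simp
    hence "(2::nat) ^ (i0 - 1) = 2 * 2 ^ (i0 - 1 - 1)" by (metis power_Suc)
    hence "N = 2 * real (blk_len CARD('n) (i0 - 1))" by (simp add: N_def blk_len_def)
    hence "29 / 2 * a * N = 29 * a * real (blk_len CARD('n) (i0 - 1))" by simp
    also have "\<dots> \<le> 2622 * \<sigma>\<^sup>2 * real CARD('n) ^ 2 / a * log_factor"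
      by (rule detection_length[OF before[OF i]])
    finally show ?thesis using a_pos by (simp add: add_increasing2)
  qed
  finally show ?thesis by (simp add: W_def)
qed

end

theorem theorem6:
  fixes A :: "real^'n^'n" and c \<theta> :: "real^'n" and \<sigma> :: real and T :: nat
    and ord :: "nat \<Rightarrow> 'n" and M :: "'a measure" and z :: "nat \<Rightarrow> 'a \<Rightarrow> real"
  assumes "CARD('n) \<ge> 2"
    and "\<sigma> > 0"
    and "spd A"
    and "bij_betw ord {..<CARD('n)} UNIV"
    and "prob_space M"
    and "prob_space.indep_vars M (\<lambda>_. borel) z UNIV"
    and "\<And>t. integrable M (z t) \<and> (\<integral>\<omega>. z t \<omega> \<partial>M) = 0"
    and "\<And>t l. integrable M (\<lambda>\<omega>. exp (l * z t \<omega>)) \<and>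
                (\<integral>\<omega>. exp (l * z t \<omega>) \<partial>M) \<le> exp (l\<^sup>2 * \<sigma>\<^sup>2 / 2)"
    and "\<theta> \<noteq> 0"
    and "T \<ge> 1"
  shows "(\<integral>\<omega>. (\<Sum>t = 1..T. (x_star A c \<theta>
            - reduction_action c A ord (2 * \<sigma>\<^sup>2) (real T / 2) 3
                (\<lambda>k. ((c + rr_action A ord k) \<bullet> \<theta> + z (2 * k + 2) \<omega>) - (c \<bullet> \<theta> + z (2 * k + 1) \<omega>))
                t) \<bullet> \<theta>) \<partial>M)
     \<le> 7 * real CARD('n) * \<sigma> * sqrt (real T)
       + 2622 * \<sigma>\<^sup>2 * real CARD('n) ^ 2 / normM A \<theta>
           * lbar (real T * (normM A \<theta>)\<^sup>2 / (4 * \<sigma>\<^sup>2 * real CARD('n) ^ 2))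
       + 2 * real T * normM A \<theta>
           * exp (negpart (2 * real CARD('n) / 3 - (1 / 9) * sqrt (real T) * normM A \<theta> / \<sigma>))
       + 392 * real CARD('n) * normM A \<theta>"
proof -
  interpret prob_space M by (rule assms)
  have sg: "subgaussian M (\<sigma>\<^sup>2) (z t)" for t
    using assms(7)[of t] assms(8)[of _ t] by (simp add: subgaussian_def borel_measurable_integrable)
  define w where "w k \<omega> = z (2 * k + 2) \<omega> - z (2 * k + 1) \<omega>" for k \<omega>
  interpret noisy_ellipsoid_bandit A c \<theta> \<sigma> T ord M w
  proof unfold_locales
    show "indep_vars (\<lambda>_. borel) w UNIV"
      unfolding w_def by (rule indep_paired_difference[OF assms(6) sg])
    show "subgaussian M (2 * \<sigma>\<^sup>2) (w k)" for k
      unfolding w_def by (rule subgaussian_paired_difference[OF assms(6) sg])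
  qed (use assms in auto)
  \<comment> \<open>Taking differences cancels the inner product of \<open>c\<close> and \<theta>,
    so the centered algorithm sees a coordinate of p plus the paired noise.\<close>
  have rewards: "(\<lambda>k. ((c + rr_action A ord k) \<bullet> \<theta> + z (2 * k + 2) \<omega>) - (c \<bullet> \<theta> + z (2 * k + 1) \<omega>))
      = rewards (\<lambda>k. w k \<omega>)" for \<omega>
    by (simp add: fun_eq_iff rewards_def w_def inner_add_left rr_action_inner[OF A] p_def)
  \<comment> \<open>The terms of order a d are 3 from the ceiling and 29/2 from the case i0 = 1;
    their sum is below 392.\<close>
  have "0 \<le> a * real CARD('n)" using a_pos by simp
  thus ?thesis
    using expected_regret
    unfolding rewards regret_def[symmetric] normM_\<theta> log_factor_def[symmetric] opposite_def[symmetric] phase23_def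
    by (simp add: mult_ac)
qed

end
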